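(* Every node $p \notin S_0$ that is active at time $t_p^e + 2D$ joins by time $t_p^e + 2D$.
   Context: Model: an asynchronous message-passing system in which an adversary generates, for each node $p$, at most one Enter($p$), Leave($p$) and Crash($p$) signal (a Leave($p$) signal for a crashed node $p$ may be generated at another active node, a forced leave, which counts toward churn). A node is present at time $t$ if it has entered but not left by $t$; $N(t)$ is the number of nodes present at time $t$, with $N(t) \geq N_{min}$ always; $S_0$ is the set of nodes present at time 0. A crashed node takes no more steps; a node is active at $t$ if present and not crashed by $t$. Nodes communicate by broadcast: a message broadcast by $p$ at time $t$ is received within $D$ time by every node $q \neq p$ active throughout $[t,t+D]$ ($D$ unknown to nodes, no lower bound on delays; FIFO per sender/receiver pair). Churn: for some constant $\alpha<1$, for all $t$ at most $\alpha N(t)$ nodes enter or leave during $[t,t+D]$. Failures: for some constant $\Delta<1$, at any time $t$ at most $\Delta N(t)$ present nodes have crashed. Algorithm (CCReg, joining part): each node $p$ keeps a set $Changes_p$ of events $enter(q)$, $join(q)$, $leave(q)$; initially $Changes_p = \{enter(q), join(q) : q \in S_0\}$ if $p \in S_0$ and empty otherwise; $Present_p = \{q : enter(q) \in Changes_p, leave(q) \notin Changes_p\}$. Nodes of $S_0$ are joined at time 0. When $p$ receives Enter($p$), it adds $enter(p)$ to $Changes_p$ and broadcasts an enter message; $t_p^e$ is this time. A node receiving an enter message from $q$ adds $enter(q)$ to its Changes set and broadcasts an enter-echo containing its Changes set, its register value and timestamp, its is_joined flag, and $q$. On receiving an enter-echo, a node unions the contained Changes set into its own; if the echo is addressed to $p$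 and $p$ has not joined, then the first time such an echo comes from a joined node $p$ sets $join\_bound := \gamma |Present_p|$, $p$ increments $join\_counter$, and once $join\_counter \geq join\_bound > 0$, $p$ joins: it sets is_joined, adds $join(p)$ and broadcasts a joined message. Receivers of a joined message for $q$ add $join(q)$, $enter(q)$ and broadcast a joined-echo (whose receivers do the same); a leave message for $q$ (broadcast by $q$, or by another node for a forced leave) causes receivers to add $leave(q)$ and broadcast a leave-echo, whose receivers add $leave(q)$. Assumptions: $\alpha \leq 1 - 2^{-1/4}$; $1 < ((1-\alpha)^3 - \Delta(1+\alpha)^3)N_{min}$; $\gamma \geq \frac{1}{N_{min}(1-\alpha)^3} + (1+\Delta)\frac{(1+\alpha)^3}{(1-\alpha)^3} - 1$; $\gamma \leq \frac{(1-\alpha)^3}{(1+\alpha)^3} - \Delta$. *)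

theory Defs
  imports Complex_Main
begin

datatype 'n chg = Ent 'n | Jn 'n | Lv 'n

text \<open>Messages of the joining part.  MEcho C j q is an enter-echo carrying the
  sender's Changes set C, its is_joined flag j, addressed to (i.e. about) node q.\<close>
datatype 'n msg =
    MEnter 'n
  | MEcho "'n chg set" bool 'n
  | MJoined 'n
  | MJEcho 'n
  | MLeave 'n
  | MLEcho 'n

text \<open>Inputs handled by a node in one atomic step.  NoOp is a fictitious padding
  step (no effect).  SigLeave q at a node r with r = q is an ordinary Leave signal,
  with r \<noteq> q a forced leave of the crashed node q.  Recv src m is the receipt
  of message m broadcast by src.\<close>
datatype 'n inp = NoOp | SigEnter | SigLeave 'n | SigCrash | Recv 'n "'n msg"

fun isRecv :: "'n inp \<Rightarrow> bool" where
  "isRecv (Recv _ _) = True"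
| "isRecv _ = False"

fun recv_src :: "'n inp \<Rightarrow> 'n" where
  "recv_src (Recv s _) = s"
| "recv_src _ = undefined"

record 'n lstate =
  changes :: "'n chg set"
  is_joined :: bool
  join_bound :: real
  bound_set :: bool
  join_counter :: nat

definition present_set :: "'n chg set \<Rightarrow> 'n set" where
  "present_set C = {q. Ent q \<in> C \<and> Lv q \<notin> C}"

definition init_state :: "'n set \<Rightarrow> 'n \<Rightarrow> 'n lstate" where
  "init_state S0 p =
     (if p \<in> S0 then
        \<lparr>changes = Ent ` S0 \<union> Jn ` S0, is_joined = True, join_bound = 0,
         bound_set = False, join_counter = 0\<rparr>
      else
        \<lparr>changes = {}, is_joined = False, join_bound = 0,
         bound_set = False, join_counter = 0\<rparr>)"

definition echo_step ::
  "real \<Rightarrow> 'n \<Rightarrow> 'n lstate \<Rightarrow> 'n chg set \<Rightarrow> bool \<Rightarrow> 'n \<Rightarrow> 'n lstate \<times> 'n msg list" where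
  "echo_step \<gamma> p s C j q =
    (let s1 = s\<lparr>changes := changes s \<union> C\<rparr> in
     if q = p \<and> \<not> is_joined s1 then
       (let s2 = (if j \<and> \<not> bound_set s1
                  then s1\<lparr>join_bound := \<gamma> * real (card (present_set (changes s1))),
                          bound_set := True\<rparr>
                  else s1);
            s3 = s2\<lparr>join_counter := Suc (join_counter s2)\<rparr>
        in if real (join_counter s3) \<ge> join_bound s3 \<and> join_bound s3 > 0
           then (s3\<lparr>is_joined := True, changes := insert (Jn p) (changes s3)\<rparr>, [MJoined p])
           else (s3, []))
     else (s1, []))"

definition step :: "real \<Rightarrow> 'n \<Rightarrow> 'n lstate \<Rightarrow> 'n inp \<Rightarrow> 'n lstate \<times> 'n msg list" where
  "step \<gamma> p s i =
    (case i of
       NoOp \<Rightarrow> (s, [])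
     | SigEnter \<Rightarrow> (s\<lparr>changes := insert (Ent p) (changes s)\<rparr>, [MEnter p])
     | SigLeave q \<Rightarrow> (s\<lparr>changes := insert (Lv q) (changes s)\<rparr>, [MLeave q])
     | SigCrash \<Rightarrow> (s, [])
     | Recv src m \<Rightarrow>
        (case m of
           MEnter q \<Rightarrow>
             (let C = insert (Ent q) (changes s)
              in (s\<lparr>changes := C\<rparr>, [MEcho C (is_joined s) q]))
         | MEcho C j q \<Rightarrow> echo_step \<gamma> p s C j q
         | MJoined q \<Rightarrow> (s\<lparr>changes := changes s \<union> {Jn q, Ent q}\<rparr>, [MJEcho q])
         | MJEcho q \<Rightarrow> (s\<lparr>changes := changes s \<union> {Jn q, Ent q}\<rparr>, [])
         | MLeave q \<Rightarrow> (s\<lparr>changes := insert (Lv q) (changes s)\<rparr>, [MLEcho q])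
         | MLEcho q \<Rightarrow> (s\<lparr>changes := insert (Lv q) (changes s)\<rparr>, [])))"

text \<open>An execution: a global sequence of atomic steps; step i happens at real
  time tm i at node nd i on input inp i; for a receipt step i, dl i = (i', k)
  identifies the delivered message as the k-th message broadcast in step i'.\<close>
record 'n execution =
  S0 :: "'n set"
  tm :: "nat \<Rightarrow> real"
  nd :: "nat \<Rightarrow> 'n"
  inp :: "nat \<Rightarrow> 'n inp"
  dl :: "nat \<Rightarrow> nat \<times> nat"

primrec cfg :: "real \<Rightarrow> 'n execution \<Rightarrow> nat \<Rightarrow> 'n \<Rightarrow> 'n lstate" where
  "cfg \<gamma> E 0 = init_state (S0 E)"
| "cfg \<gamma> E (Suc i) =
     (cfg \<gamma> E i)(nd E i := fst (step \<gamma> (nd E i) (cfg \<gamma> E i (nd E i)) (inp E i)))"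

definition out :: "real \<Rightarrow> 'n execution \<Rightarrow> nat \<Rightarrow> 'n msg list" where
  "out \<gamma> E i = snd (step \<gamma> (nd E i) (cfg \<gamma> E i (nd E i)) (inp E i))"

definition entered :: "'n execution \<Rightarrow> 'n \<Rightarrow> real \<Rightarrow> bool" where
  "entered E p t \<longleftrightarrow> p \<in> S0 E \<or> (\<exists>i. nd E i = p \<and> inp E i = SigEnter \<and> tm E i \<le> t)"

definition has_left :: "'n execution \<Rightarrow> 'n \<Rightarrow> real \<Rightarrow> bool" where
  "has_left E p t \<longleftrightarrow> (\<exists>i. inp E i = SigLeave p \<and> tm E i \<le> t)"

definition crashed :: "'n execution \<Rightarrow> 'n \<Rightarrow> real \<Rightarrow> bool" where
  "crashed E p t \<longleftrightarrow> (\<exists>i. nd E i = p \<and> inp E i = SigCrash \<and> tm E i \<le> t)"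

definition present :: "'n execution \<Rightarrow> 'n \<Rightarrow> real \<Rightarrow> bool" where
  "present E p t \<longleftrightarrow> entered E p t \<and> \<not> has_left E p t"

definition active :: "'n execution \<Rightarrow> 'n \<Rightarrow> real \<Rightarrow> bool" where
  "active E p t \<longleftrightarrow> present E p t \<and> \<not> crashed E p t"

definition Npres :: "'n execution \<Rightarrow> real \<Rightarrow> nat" where
  "Npres E t = card {p. present E p t}"

definition entered_before :: "'n execution \<Rightarrow> 'n \<Rightarrow> nat \<Rightarrow> bool" where
  "entered_before E p i \<longleftrightarrow> p \<in> S0 E \<or> (\<exists>i'<i. nd E i' = p \<and> inp E i' = SigEnter)"

definition crashed_before :: "'n execution \<Rightarrow> 'n \<Rightarrow> nat \<Rightarrow> bool" where
  "crashed_before E p i \<longleftrightarrow> (\<exists>i'<i. nd E i' = p \<and> inp E i' = SigCrash)"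

definition active_before :: "'n execution \<Rightarrow> 'n \<Rightarrow> nat \<Rightarrow> bool" where
  "active_before E p i \<longleftrightarrow> entered_before E p i \<and> \<not> (\<exists>i'<i. inp E i' = SigLeave p)
                            \<and> \<not> crashed_before E p i"

definition ccreg_execution :: "real \<Rightarrow> real \<Rightarrow> 'n execution \<Rightarrow> bool" where
  "ccreg_execution \<gamma> D E \<longleftrightarrow>
     \<comment> \<open>timing: times nonnegative, nondecreasing, unbounded\<close>
     (\<forall>i. 0 \<le> tm E i) \<and>
     (\<forall>i j. i \<le> j \<longrightarrow> tm E i \<le> tm E j) \<and>
     (\<forall>T. \<exists>i. T < tm E i) \<and>
     \<comment> \<open>only active nodes take steps; Enter(p) only for a node that has not entered\<close>
     (\<forall>i. inp E i \<noteq> NoOp \<longrightarrow>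
        (if inp E i = SigEnter then \<not> entered_before E (nd E i) i
         else active_before E (nd E i) i)) \<and>
     \<comment> \<open>S0 is the set of nodes present at time 0: Enter/Leave signals happen after time 0\<close>
     (\<forall>i. inp E i = SigEnter \<longrightarrow> 0 < tm E i) \<and>
     (\<forall>i q. inp E i = SigLeave q \<longrightarrow> 0 < tm E i) \<and>
     \<comment> \<open>at most one Leave(q) signal; a forced leave only for a crashed node\<close>
     (\<forall>i j q. inp E i = SigLeave q \<and> inp E j = SigLeave q \<longrightarrow> i = j) \<and>
     (\<forall>i q. inp E i = SigLeave q \<and> q \<noteq> nd E i \<longrightarrow> crashed_before E q i) \<and>
     \<comment> \<open>every receipt is of a message broadcast earlier by another node\<close>
     (\<forall>j src m. inp E j = Recv src m \<longrightarrow>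
        fst (dl E j) < j \<and> nd E (fst (dl E j)) = src \<and> src \<noteq> nd E j \<and>
        snd (dl E j) < length (out \<gamma> E (fst (dl E j))) \<and>
        out \<gamma> E (fst (dl E j)) ! snd (dl E j) = m) \<and>
     \<comment> \<open>each message is received at most once by each node\<close>
     (\<forall>j j'. j \<noteq> j' \<and> isRecv (inp E j) \<and> isRecv (inp E j') \<and> nd E j = nd E j'
        \<longrightarrow> dl E j \<noteq> dl E j') \<and>
     \<comment> \<open>FIFO per sender/receiver pair\<close>
     (\<forall>j j'. j < j' \<and> isRecv (inp E j) \<and> isRecv (inp E j') \<and> nd E j = nd E j'
        \<and> recv_src (inp E j) = recv_src (inp E j') \<longrightarrow>
        fst (dl E j) < fst (dl E j') \<or>
        (fst (dl E j) = fst (dl E j') \<and> snd (dl E j) < snd (dl E j'))) \<and>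
     \<comment> \<open>reliable delivery within D to every node active throughout [t, t+D]\<close>
     (\<forall>i k q. k < length (out \<gamma> E i) \<and> q \<noteq> nd E i \<and>
        (\<forall>t. tm E i \<le> t \<and> t \<le> tm E i + D \<longrightarrow> active E q t) \<longrightarrow>
        (\<exists>j. nd E j = q \<and> inp E j = Recv (nd E i) (out \<gamma> E i ! k) \<and> dl E j = (i, k)
             \<and> tm E j \<le> tm E i + D)) \<and>
     \<comment> \<open>N(t) is a (finite) number\<close>
     (\<forall>t\<ge>0. finite {p. present E p t})"

definition churn_ok :: "real \<Rightarrow> real \<Rightarrow> 'n execution \<Rightarrow> bool" where
  "churn_ok \<alpha> D E \<longleftrightarrow>
     (\<forall>t\<ge>0. let Ch = {p. \<exists>i. (nd E i = p \<and> inp E i = SigEnter \<or> inp E i = SigLeave p)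
                               \<and> t \<le> tm E i \<and> tm E i \<le> t + D}
            in finite Ch \<and> real (card Ch) \<le> \<alpha> * real (Npres E t))"

definition failures_ok :: "real \<Rightarrow> 'n execution \<Rightarrow> bool" where
  "failures_ok \<Delta> E \<longleftrightarrow>
     (\<forall>t\<ge>0. real (card {p. present E p t \<and> crashed E p t}) \<le> \<Delta> * real (Npres E t))"

definition joined_by :: "real \<Rightarrow> 'n execution \<Rightarrow> 'n \<Rightarrow> real \<Rightarrow> bool" where
  "joined_by \<gamma> E p T \<longleftrightarrow> (\<exists>j. tm E j \<le> T \<and> is_joined (cfg \<gamma> E (Suc j) p))"

end

theory Submission
  imports Defs
begin

text \<open>
  Two claims are proved together by induction on the step index: a joined node knows every enter
  and leave event that is more than \<open>2 D\<close> old, and a node that stays active joins within \<open>2 D\<close>.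

  Joining. Some node present \<open>2 D\<close> before \<open>p\<close> enters survives until \<open>D\<close> after, has joined, and
  echoes. The joined sender of the echo that fixes the threshold knows all old departures, so the
  threshold is at most \<open>\<gamma> (1 + \<alpha>)\<^sup>3 N\<close>, where \<open>N\<close> is the population \<open>2 D\<close> before that echo was
  sent. At least \<open>((1 - \<alpha>)\<^sup>3 - \<Delta> (1 + \<alpha>)\<^sup>3) N\<close> of these nodes live long enough to echo in time, and
  the upper bound on \<open>\<gamma>\<close> says that this reaches the threshold.

  Knowledge. By the lower bound on \<open>\<gamma>\<close>, a node that joins has heard more echoes than there are
  nodes that enter or leave around that time or crash. So some echo comes from a node that was
  active throughout the \<open>D\<close> time units after any given recent event, and this node passes the event
  on. A late-entering node may echo an arbitrarily old enter message, hence this window spans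
  \<open>4 D\<close>, and the count uses that \<open>p\<close> has joined in time.
\<close>

subsection \<open>The join protocol of a single node\<close>

fun carried :: "'n msg \<Rightarrow> 'n chg set" where
  "carried (MEnter q) = {Ent q}"
| "carried (MEcho C b q) = C"
| "carried (MJoined q) = {Jn q, Ent q}"
| "carried (MJEcho q) = {Jn q, Ent q}"
| "carried (MLeave q) = {Lv q}"
| "carried (MLEcho q) = {Lv q}"

lemma carried_subset_step: "carried m \<subseteq> changes (fst (step \<gamma> p s (Recv src m)))"
  by (cases m) (auto simp: step_def echo_step_def Let_def)

lemma changes_step_mono: "changes s \<subseteq> changes (fst (step \<gamma> p s i))"
  by (auto simp: step_def echo_step_def Let_def split: inp.split msg.split)

lemma is_joined_step_mono: "is_joined s \<Longrightarrow> is_joined (fst (step \<gamma> p s i))"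
  by (auto simp: step_def echo_step_def Let_def split: inp.split msg.split)

text \<open>Hence a message is identified by the step that broadcasts it, and the index in
  \<open>dl\<close> is always 0.\<close>

lemma length_step_out: "length (snd (step \<gamma> p s i)) \<le> 1"
  by (auto simp: step_def echo_step_def Let_def split: inp.split msg.split)

lemma step_out_MEcho:
  assumes "snd (step \<gamma> p s i) = [MEcho C b q]"
  shows "\<exists>src. i = Recv src (MEnter q) \<and> C = changes (fst (step \<gamma> p s i)) \<and> b = is_joined s"
  using assms by (auto simp: step_def echo_step_def Let_def split: inp.splits msg.splits if_splits)

lemma step_out_MEnter:
  assumes "snd (step \<gamma> p s i) = [MEnter q]"
  shows "i = SigEnter \<and> q = p"
  using assms by (auto simp: step_def echo_step_def Let_def split: inp.splits msg.splits if_splits)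

section \<open>Events and the history of received echoes\<close>

definition event :: "'n execution \<Rightarrow> nat \<Rightarrow> 'n chg \<Rightarrow> bool" where
  "event E i e \<longleftrightarrow> inp E i = SigEnter \<and> e = Ent (nd E i) \<or> (\<exists>q. inp E i = SigLeave q \<and> e = Lv q)"

text \<open>Join entries carry no claim: \<open>present_set\<close> ignores them.\<close>

fun occurred_before :: "'n execution \<Rightarrow> nat \<Rightarrow> 'n chg \<Rightarrow> bool" where
  "occurred_before E i (Ent q) \<longleftrightarrow> entered_before E q i"
| "occurred_before E i (Jn q) \<longleftrightarrow> True"
| "occurred_before E i (Lv q) \<longleftrightarrow> (\<exists>i'<i. inp E i' = SigLeave q)"

lemma occurred_before_mono: "occurred_before E i e \<Longrightarrow> i \<le> j \<Longrightarrow> occurred_before E j e"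
  by (cases e) (auto simp: entered_before_def intro: less_le_trans)

text \<open>The history behind \<open>join_counter\<close>. Steps rather than senders are recorded,
  so that each echo can be traced back to the moment it was sent.\<close>

definition echo_receipts :: "'n execution \<Rightarrow> 'n \<Rightarrow> nat \<Rightarrow> nat set" where
  "echo_receipts E p k = {j. j < k \<and> nd E j = p \<and> (\<exists>src C b. inp E j = Recv src (MEcho C b p))}"

definition joined_echo_receipts :: "'n execution \<Rightarrow> 'n \<Rightarrow> nat \<Rightarrow> nat set" where
  "joined_echo_receipts E p k = {j. j < k \<and> nd E j = p \<and> (\<exists>src C. inp E j = Recv src (MEcho C True p))}"

lemma finite_echo_receipts [simp]: "finite (echo_receipts E p k)"
  by (rule finite_subset[of _ "{..<k}"]) (auto simp: echo_receipts_def)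

lemma echo_receipts_Suc:
  "echo_receipts E p (Suc k) =
     (if nd E k = p \<and> (\<exists>src C b. inp E k = Recv src (MEcho C b p))
      then insert k (echo_receipts E p k) else echo_receipts E p k)"
  by (auto simp: echo_receipts_def less_Suc_eq)

lemma joined_echo_receipts_Suc:
  "joined_echo_receipts E p (Suc k) =
     (if nd E k = p \<and> (\<exists>src C. inp E k = Recv src (MEcho C True p))
      then insert k (joined_echo_receipts E p k) else joined_echo_receipts E p k)"
  by (auto simp: joined_echo_receipts_def less_Suc_eq)

text \<open>The state is taken after step \<open>j\<close> because the algorithm counts after
  merging the echo. A join entry added in the same step does not change the count.\<close>

definition join_threshold :: "real \<Rightarrow> 'n execution \<Rightarrow> 'n \<Rightarrow> nat \<Rightarrow> real" where
  "join_threshold \<gamma> E p j = \<gamma> * real (card (present_set (changes (cfg \<gamma> E (Suc j) p))))"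

text \<open>Ties the local variables to the history. The counter is described only for unjoined
  nodes, since counting stops on joining. The last conjunct remembers the joining step
  \<open>j\<close> and an echo \<open>j'\<close>, possibly \<open>j\<close> itself, that fixed the
  bound.\<close>

definition join_inv :: "real \<Rightarrow> 'n execution \<Rightarrow> nat \<Rightarrow> 'n \<Rightarrow> bool" where
  "join_inv \<gamma> E k p \<longleftrightarrow>
    (let s = cfg \<gamma> E k p in
      (\<not> is_joined s \<longrightarrow> join_counter s = card (echo_receipts E p k)) \<and>
      (bound_set s \<longrightarrow> (\<exists>j\<in>joined_echo_receipts E p k. join_bound s = join_threshold \<gamma> E p j)) \<and>
      (\<not> is_joined s \<and> joined_echo_receipts E p k \<noteq> {} \<longrightarrow> bound_set s) \<and>
      (\<not> bound_set s \<longrightarrow> join_bound s = 0) \<and>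
      (\<not> is_joined s \<longrightarrow> \<not> (real (join_counter s) \<ge> join_bound s \<and> join_bound s > 0)) \<and>
      (is_joined s \<longrightarrow> (\<exists>j<k. \<exists>j'\<in>joined_echo_receipts E p (Suc j).
          j \<in> echo_receipts E p (Suc j) \<and> \<not> is_joined (cfg \<gamma> E j p) \<and>
          join_threshold \<gamma> E p j' \<le> real (card (echo_receipts E p (Suc j))))))"

lemma present_set_insert_Jn [simp]: "present_set (insert (Jn p) C) = present_set C"
  by (auto simp: present_set_def)

lemma step_not_own_echo:
  assumes "\<nexists>src C b. i = Recv src (MEcho C b p)"
  shows "is_joined (fst (step \<gamma> p s i)) = is_joined s"
    "join_counter (fst (step \<gamma> p s i)) = join_counter s"
    "join_bound (fst (step \<gamma> p s i)) = join_bound s"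
    "bound_set (fst (step \<gamma> p s i)) = bound_set s"
  using assms
  by (auto simp: step_def echo_step_def Let_def split: inp.split msg.split)

lemma join_inv_Suc_unchanged:
  assumes inv: "join_inv \<gamma> E k p"
    and "echo_receipts E p (Suc k) = echo_receipts E p k"
    and "joined_echo_receipts E p (Suc k) = joined_echo_receipts E p k"
    and "is_joined (cfg \<gamma> E (Suc k) p) = is_joined (cfg \<gamma> E k p)"
    and "join_counter (cfg \<gamma> E (Suc k) p) = join_counter (cfg \<gamma> E k p)"
    and "join_bound (cfg \<gamma> E (Suc k) p) = join_bound (cfg \<gamma> E k p)"
    and "bound_set (cfg \<gamma> E (Suc k) p) = bound_set (cfg \<gamma> E k p)"
  shows "join_inv \<gamma> E (Suc k) p"
  using inv unfolding join_inv_def Let_def assms(2-) by (meson less_Suc_eq)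

text \<open>Only echoes addressed to \<open>p\<close> touch the join variables, so one case of the
  induction carries the content. Nodes of \<open>S0\<close> are excluded since they start joined
  without having received any echo.\<close>

lemma join_inv_holds:
  assumes "p \<notin> S0 E"
  shows "join_inv \<gamma> E k p"
proof (induction k)
  case 0
  show ?case
    using assms by (simp add: join_inv_def init_state_def echo_receipts_def joined_echo_receipts_def)
next
  case (Suc k)
  show ?case
  proof (cases "nd E k = p \<and> (\<exists>src C b. inp E k = Recv src (MEcho C b p))")
    case False
    show ?thesis
    proof (rule join_inv_Suc_unchanged[OF Suc])
      show "echo_receipts E p (Suc k) = echo_receipts E p k"
        using False unfolding echo_receipts_Suc by (rule if_not_P)
      show "joined_echo_receipts E p (Suc k) = joined_echo_receipts E p k"
        using False unfolding joined_echo_receipts_Suc by metis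
    qed (use False in \<open>auto simp: step_not_own_echo\<close>)
  next
    case True
    then obtain src C b where p: "nd E k = p" and i: "inp E k = Recv src (MEcho C b p)"
      by blast
    define s where "s = cfg \<gamma> E k p"
    define s' where "s' = cfg \<gamma> E (Suc k) p"
    have s': "s' = fst (echo_step \<gamma> p s C b p)"
      using p i by (simp add: s'_def s_def step_def)
    have k_notin: "k \<notin> echo_receipts E p k"
      by (simp add: echo_receipts_def)
    have R: "echo_receipts E p (Suc k) = insert k (echo_receipts E p k)"
      using True unfolding echo_receipts_Suc by simp
    have RJ: "joined_echo_receipts E p (Suc k) =
        (if b then insert k (joined_echo_receipts E p k) else joined_echo_receipts E p k)"
      using p i unfolding joined_echo_receipts_Suc by auto
    have c: "card (echo_receipts E p (Suc k)) = Suc (card (echo_receipts E p k))"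
      using k_notin by (simp add: R)
    have inv: "join_inv \<gamma> E k p" by (rule Suc)
    show ?thesis
    proof (cases "is_joined s")
      case True
      then have "is_joined s'" "bound_set s' = bound_set s" "join_bound s' = join_bound s"
        by (auto simp: s' echo_step_def Let_def)
      with True inv show ?thesis
        unfolding join_inv_def Let_def s_def[symmetric] s'_def[symmetric]
        by (auto simp: RJ less_Suc_eq)
    next
      case False
      have thr: "join_threshold \<gamma> E p k = \<gamma> * real (card (present_set (changes s \<union> C)))"
        using False unfolding join_threshold_def s'_def[symmetric] s'
        by (auto simp: echo_step_def Let_def)
      \<comment> \<open>The bound in force after this step: freshly computed at the first echo from
        a joined node, the old value otherwise.\<close>
      define B where "B = (if b \<and> \<not> bound_set s then join_threshold \<gamma> E p k else join_bound s)"
      have bs: "bound_set s' = (b \<or> bound_set s)" and jb: "join_bound s' = B"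
        and jc: "join_counter s' = Suc (join_counter s)"
        and ij: "is_joined s' = (real (Suc (join_counter s)) \<ge> B \<and> B > 0)"
        using False by (auto simp: s' echo_step_def Let_def B_def thr)
      have cnt: "join_counter s = card (echo_receipts E p k)"
        using inv False unfolding join_inv_def Let_def s_def[symmetric] by blast
      have bound: "\<exists>j\<in>joined_echo_receipts E p (Suc k). B = join_threshold \<gamma> E p j"
        if "b \<or> bound_set s"
        using inv that unfolding join_inv_def Let_def s_def[symmetric] by (auto simp: RJ B_def)
      \<comment> \<open>Before any echo from a joined node the bound has its default 0, which the
        test \<open>B > 0\<close> rejects.\<close>
      have B0: "B = 0" if "\<not> (b \<or> bound_set s)"
        using inv that unfolding join_inv_def Let_def s_def[symmetric] by (auto simp: B_def)
      have joined: "\<exists>j<Suc k. \<exists>j'\<in>joined_echo_receipts E p (Suc j).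
          j \<in> echo_receipts E p (Suc j) \<and> \<not> is_joined (cfg \<gamma> E j p) \<and>
          join_threshold \<gamma> E p j' \<le> real (card (echo_receipts E p (Suc j)))"
        if "is_joined s'"
      proof -
        have "B > 0" "B \<le> real (card (echo_receipts E p (Suc k)))"
          using that ij cnt c by auto
        with bound B0 show ?thesis
          using False R unfolding s_def by (metis insertI1 lessI less_irrefl)
      qed
      have "bound_set s'" if "\<not> is_joined s'" "joined_echo_receipts E p (Suc k) \<noteq> {}"
        using that inv False bs unfolding join_inv_def Let_def s_def[symmetric]
        by (auto simp: RJ split: if_splits)
      with bs jb jc ij cnt c bound B0 joined show ?thesis
        unfolding join_inv_def Let_def s'_def[symmetric] by metis
    qed
  qed
qed

subsection \<open>Executions\<close>

locale ccreg =
  fixes E :: "'n execution" and \<gamma> D :: real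
  assumes D_pos: "D > 0"
    and execution: "ccreg_execution \<gamma> D E"
begin

abbreviation st :: "nat \<Rightarrow> 'n \<Rightarrow> 'n lstate" where
  "st \<equiv> cfg \<gamma> E"

lemma execution_conjuncts:
  shows times_nonneg: "\<forall>i. 0 \<le> tm E i"
    and times_mono: "\<forall>i j. i \<le> j \<longrightarrow> tm E i \<le> tm E j"
    and times_unbounded: "\<forall>T. \<exists>i. T < tm E i"
    and steps_allowed: "\<forall>i. inp E i \<noteq> NoOp \<longrightarrow>
        (if inp E i = SigEnter then \<not> entered_before E (nd E i) i
         else active_before E (nd E i) i)"
    and enter_times_pos: "\<forall>i. inp E i = SigEnter \<longrightarrow> 0 < tm E i"
    and receipts_sent: "\<forall>j src m. inp E j = Recv src m \<longrightarrow>
        fst (dl E j) < j \<and> nd E (fst (dl E j)) = src \<and> src \<noteq> nd E j \<and>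
        snd (dl E j) < length (out \<gamma> E (fst (dl E j))) \<and>
        out \<gamma> E (fst (dl E j)) ! snd (dl E j) = m"
    and receipts_distinct: "\<forall>j j'. j \<noteq> j' \<and> isRecv (inp E j) \<and> isRecv (inp E j') \<and> nd E j = nd E j'
        \<longrightarrow> dl E j \<noteq> dl E j'"
    and deliveries: "\<forall>i k q. k < length (out \<gamma> E i) \<and> q \<noteq> nd E i \<and>
        (\<forall>t. tm E i \<le> t \<and> t \<le> tm E i + D \<longrightarrow> active E q t) \<longrightarrow>
        (\<exists>j. nd E j = q \<and> inp E j = Recv (nd E i) (out \<gamma> E i ! k) \<and> dl E j = (i, k)
             \<and> tm E j \<le> tm E i + D)"
    and present_finite: "\<forall>t\<ge>0. finite {p. present E p t}"
  using execution unfolding ccreg_execution_def by - (elim conjE, assumption)+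

lemma tm_nonneg: "0 \<le> tm E i"
  using times_nonneg ..

lemma tm_mono: "i \<le> j \<Longrightarrow> tm E i \<le> tm E j"
  using times_mono by simp

lemma tm_less_imp_less: "tm E i < tm E j \<Longrightarrow> i < j"
  by (meson leD not_le_imp_less tm_mono)

lemma enter_fresh: "inp E i = SigEnter \<Longrightarrow> \<not> entered_before E (nd E i) i"
  using steps_allowed[rule_format, of i] by simp

lemma step_active: "inp E i \<noteq> NoOp \<Longrightarrow> inp E i \<noteq> SigEnter \<Longrightarrow> active_before E (nd E i) i"
  using steps_allowed[rule_format, of i] by simp

lemma enter_time_pos: "inp E i = SigEnter \<Longrightarrow> 0 < tm E i"
  using enter_times_pos by simp

lemma finite_present: "0 \<le> t \<Longrightarrow> finite {q. present E q t}"
  using present_finite by simp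

lemma enter_unique:
  assumes "inp E i = SigEnter" "inp E j = SigEnter" "nd E i = nd E j"
  shows "i = j"
  using enter_fresh[OF assms(1)] enter_fresh[OF assms(2)] assms
  unfolding entered_before_def by (cases i j rule: linorder_cases) auto

lemma enter_not_S0: "inp E i = SigEnter \<Longrightarrow> nd E i \<notin> S0 E"
  using enter_fresh unfolding entered_before_def by blast

lemma out_singleton: "k < length (out \<gamma> E i) \<Longrightarrow> k = 0 \<and> out \<gamma> E i = [out \<gamma> E i ! 0]"
  using length_step_out[of \<gamma> "nd E i" "st i (nd E i)" "inp E i"]
  unfolding out_def[symmetric] by (cases "out \<gamma> E i") auto

lemma receipt_origin:
  assumes "inp E j = Recv src m"
  obtains i where "i < j" "nd E i = src" "src \<noteq> nd E j" "out \<gamma> E i = [m]" "dl E j = (i, 0)"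
proof -
  have *: "fst (dl E j) < j \<and> nd E (fst (dl E j)) = src \<and> src \<noteq> nd E j \<and>
        snd (dl E j) < length (out \<gamma> E (fst (dl E j))) \<and>
        out \<gamma> E (fst (dl E j)) ! snd (dl E j) = m"
    using receipts_sent assms by blast
  with out_singleton[of "snd (dl E j)" "fst (dl E j)"]
  show thesis by (intro that[of "fst (dl E j)"]) (auto simp: prod_eq_iff)
qed

lemma receipt_unique:
  assumes "inp E j = Recv src m" "inp E j' = Recv src' m'" "nd E j = nd E j'" "dl E j = dl E j'"
  shows "j = j'"
  using receipts_distinct[rule_format, of j j'] assms by auto

lemma delivery:
  assumes "out \<gamma> E i = [m]" "q \<noteq> nd E i"
    and "\<And>t. tm E i \<le> t \<Longrightarrow> t \<le> tm E i + D \<Longrightarrow> active E q t"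
  obtains j where "i < j" "nd E j = q" "inp E j = Recv (nd E i) m" "dl E j = (i, 0)"
    "tm E j \<le> tm E i + D"
proof -
  from deliveries[rule_format, of 0 i q] assms obtain j where
    j: "nd E j = q" "inp E j = Recv (nd E i) m" "dl E j = (i, 0)" "tm E j \<le> tm E i + D"
    by auto
  moreover have "i < j" using receipts_sent j(2,3) by (metis fst_conv)
  ultimately show thesis using that by blast
qed

lemma changes_mono: "i \<le> j \<Longrightarrow> changes (st i p) \<subseteq> changes (st j p)"
proof (induction rule: dec_induct)
  case (step n)
  then show ?case using changes_step_mono[of "st n (nd E n)"] by fastforce
qed simp

lemma is_joined_mono: "i \<le> j \<Longrightarrow> is_joined (st i p) \<Longrightarrow> is_joined (st j p)"
  by (induction rule: dec_induct) (auto intro: is_joined_step_mono)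

lemma S0_joined: "q \<in> S0 E \<Longrightarrow> is_joined (st k q)"
  by (rule is_joined_mono[of 0]) (auto simp: init_state_def)

section \<open>Contents of messages and of Changes sets\<close>

lemma carried_in_changes:
  assumes "inp E j = Recv src m" "e \<in> carried m" "Suc j \<le> k"
  shows "e \<in> changes (st k (nd E j))"
proof -
  have "e \<in> changes (st (Suc j) (nd E j))"
    using assms carried_subset_step[of m] by fastforce
  with changes_mono[OF assms(3)] show ?thesis by blast
qed

lemma event_in_changes:
  assumes "event E i e" "Suc i \<le> k"
  shows "e \<in> changes (st k (nd E i))"
proof -
  have "e \<in> changes (st (Suc i) (nd E i))"
    using assms(1) by (auto simp: event_def step_def)
  with changes_mono[OF assms(2)] show ?thesis by blast
qed

text \<open>The third property is a relay round: an enter message is answered by an echo whose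
  Changes set already holds the new entry, a leave message by a leave-echo. There is no further hop,
  since echoes are not themselves echoed.\<close>

lemma event_broadcast:
  assumes "event E i e"
  obtains m where "out \<gamma> E i = [m]" "e \<in> carried m"
    "\<And>j src. inp E j = Recv src m \<Longrightarrow> \<exists>m'. out \<gamma> E j = [m'] \<and> e \<in> carried m'"
proof -
  from assms consider "inp E i = SigEnter" "e = Ent (nd E i)"
    | q where "inp E i = SigLeave q" "e = Lv q"
    unfolding event_def by blast
  then show thesis
  proof cases
    case 1
    then show thesis
      by (intro that[of "MEnter (nd E i)"]) (auto simp: out_def step_def Let_def)
  next
    case 2
    then show thesis
      by (intro that[of "MLeave q"]) (auto simp: out_def step_def Let_def)
  qed
qed

text \<open>Changes sets and messages have to be treated together: a receipt moves entries from a
  message into a set, and an echo moves a set into a message.\<close>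

lemma occurred_before_step:
  assumes ch: "\<And>p e. e \<in> changes (st k p) \<Longrightarrow> occurred_before E k e"
    and ms: "\<And>i m e. i < k \<Longrightarrow> out \<gamma> E i = [m] \<Longrightarrow> e \<in> carried m \<Longrightarrow> occurred_before E k e"
  shows "e \<in> changes (st (Suc k) p) \<Longrightarrow> occurred_before E (Suc k) e"
    and "out \<gamma> E k = [m] \<Longrightarrow> e \<in> carried m \<Longrightarrow> occurred_before E (Suc k) e"
proof -
  let ?s = "st k (nd E k)"
  have ch': "occurred_before E (Suc k) e" if "e \<in> changes (st k p)" for p e
    using occurred_before_mono[OF ch[OF that]] by simp
  have recv: "occurred_before E (Suc k) e"
    if "inp E k = Recv src m" "e \<in> carried m" for src m e
  proof -
    from receipt_origin[OF that(1)] obtain i where "i < k" "out \<gamma> E i = [m]" by blast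
    then have "occurred_before E k e" using ms that(2) by blast
    then show ?thesis by (rule occurred_before_mono) simp
  qed
  \<comment> \<open>A joined message carries its sender's own enter entry, so a node that takes a
    step must be known to have entered.\<close>
  have self: "occurred_before E (Suc k) (Ent (nd E k))" if "inp E k \<noteq> NoOp"
    using that step_active[of k] unfolding active_before_def
    by (cases "inp E k = SigEnter") (auto simp: entered_before_def intro: less_SucI)
  have ch0: "\<forall>e\<in>changes ?s. occurred_before E (Suc k) e"
    using ch' by blast
  have "(\<forall>e\<in>changes (fst (step \<gamma> (nd E k) ?s (inp E k))). occurred_before E (Suc k) e) \<and>
      (\<forall>m. snd (step \<gamma> (nd E k) ?s (inp E k)) = [m] \<longrightarrow> (\<forall>e\<in>carried m. occurred_before E (Suc k) e))"
  proof (cases "inp E k")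
    case NoOp
    then show ?thesis using ch0 by (simp add: step_def)
  next
    case SigEnter
    then show ?thesis using ch0 self by (simp add: step_def)
  next
    case (SigLeave q)
    then have "occurred_before E (Suc k) (Lv q)" by auto
    then show ?thesis using ch0 unfolding SigLeave by (simp add: step_def)
  next
    case SigCrash
    then show ?thesis using ch0 by (simp add: step_def)
  next
    case (Recv src m)
    have self': "occurred_before E (Suc k) (Ent (nd E k))" using self Recv by simp
    note r = recv[OF Recv]
    show ?thesis
    proof (cases m)
      case (MEcho C b q)
      show ?thesis
        using r self' ch0 unfolding Recv MEcho step_def inp.case msg.case echo_step_def Let_def
        by auto
    next
      case (MJoined q)
      have "occurred_before E (Suc k) (Ent q)" by (rule r) (simp add: MJoined)
      then show ?thesis using ch0 unfolding Recv MJoined by (simp add: step_def)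
    next
      case (MJEcho q)
      have "occurred_before E (Suc k) (Ent q)" by (rule r) (simp add: MJEcho)
      then show ?thesis using ch0 unfolding Recv MJEcho by (simp add: step_def)
    next
      case (MEnter q)
      have "occurred_before E (Suc k) (Ent q)" by (rule r) (simp add: MEnter)
      then show ?thesis using ch0 unfolding Recv MEnter by (simp add: step_def Let_def)
    next
      case (MLeave q)
      have "occurred_before E (Suc k) (Lv q)" by (rule r) (simp add: MLeave)
      then show ?thesis using ch0 unfolding Recv MLeave by (simp add: step_def)
    next
      case (MLEcho q)
      have "occurred_before E (Suc k) (Lv q)" by (rule r) (simp add: MLEcho)
      then show ?thesis using ch0 unfolding Recv MLEcho by (simp add: step_def)
    qed
  qed
  note * = this
  show "occurred_before E (Suc k) e" if "e \<in> changes (st (Suc k) p)"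
  proof (cases "p = nd E k")
    case True
    with that have "e \<in> changes (fst (step \<gamma> (nd E k) ?s (inp E k)))" by simp
    with * show ?thesis by blast
  next
    case False
    with that have "e \<in> changes (st k p)" by simp
    then show ?thesis by (rule ch')
  qed
  show "occurred_before E (Suc k) e" if "out \<gamma> E k = [m]" "e \<in> carried m"
    using * that unfolding out_def by blast
qed

text \<open>Soundness, the counterpart of the completeness expressed by \<open>knows\<close>.
  Bounding \<open>present_set\<close> from above takes sound enters and complete leaves, bounding it
  from below the reverse.\<close>

lemma changes_occurred: "e \<in> changes (st k p) \<Longrightarrow> occurred_before E k e"
proof -
  have "(\<forall>p. \<forall>e\<in>changes (st k p). occurred_before E k e) \<and>
    (\<forall>i<k. \<forall>m e. out \<gamma> E i = [m] \<longrightarrow> e \<in> carried m \<longrightarrow> occurred_before E k e)"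
  proof (induction k)
    case 0
    show ?case by (auto simp: init_state_def entered_before_def)
  next
    case (Suc k)
    have "occurred_before E (Suc k) e" if "i < Suc k" "out \<gamma> E i = [m]" "e \<in> carried m" for i m e
    proof (cases "i = k")
      case True
      with occurred_before_step(2)[of k] Suc that show ?thesis by blast
    next
      case False
      with that have "i < k" by simp
      with Suc that have "occurred_before E k e" by blast
      then show ?thesis by (rule occurred_before_mono) simp
    qed
    moreover have "occurred_before E (Suc k) e" if "e \<in> changes (st (Suc k) p)" for p e
      using occurred_before_step(1)[of k, OF _ _ that] Suc by blast
    ultimately show ?case by blast
  qed
  then show "e \<in> changes (st k p) \<Longrightarrow> occurred_before E k e" by blast
qed

text \<open>Traces an echo two hops back: to the sender's receipt of the enter message, then to the
  Enter signal. The flag is read before the sender's step, the Changes set after it.\<close>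

lemma echo_origin:
  assumes "inp E j = Recv src (MEcho C b q)"
  obtains i ie where "i < j" "nd E i = src" "src \<noteq> nd E j" "out \<gamma> E i = [MEcho C b q]"
    "dl E j = (i, 0)" "inp E i = Recv q (MEnter q)" "C = changes (st (Suc i) src)"
    "b = is_joined (st i src)" "ie < i" "nd E ie = q" "inp E ie = SigEnter" "dl E i = (ie, 0)"
proof -
  obtain i where i: "i < j" "nd E i = src" "src \<noteq> nd E j" "out \<gamma> E i = [MEcho C b q]"
      "dl E j = (i, 0)"
    using receipt_origin[OF assms] by blast
  obtain src' where src': "inp E i = Recv src' (MEnter q)" "C = changes (st (Suc i) src)"
      "b = is_joined (st i src)"
    using step_out_MEcho[OF i(4)[unfolded out_def]] i(2) by auto
  obtain ie where ie: "ie < i" "nd E ie = src'" "out \<gamma> E ie = [MEnter q]" "dl E i = (ie, 0)"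
    using receipt_origin[OF src'(1)] by blast
  from step_out_MEnter[OF ie(3)[unfolded out_def]] ie(2) have "inp E ie = SigEnter" "src' = q"
    by auto
  with i ie src' that show thesis by blast
qed

lemma enter_reply:
  assumes "inp E i = Recv src (MEnter q)"
  shows "out \<gamma> E i = [MEcho (changes (st (Suc i) (nd E i))) (is_joined (st i (nd E i))) q]"
  using assms by (simp add: out_def step_def Let_def)

lemma enter_broadcast: "inp E i = SigEnter \<Longrightarrow> out \<gamma> E i = [MEnter (nd E i)]"
  by (simp add: out_def step_def)

text \<open>A node enters once and every other node receives its enter message at most once, hence
  echoes it at most once. So counting echoes counts nodes.\<close>

lemma inj_on_echo_sender: "inj_on (\<lambda>j. recv_src (inp E j)) (echo_receipts E p k)"
proof (rule inj_onI)
  fix j j' assume jj: "j \<in> echo_receipts E p k" "j' \<in> echo_receipts E p k"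
    and eq: "recv_src (inp E j) = recv_src (inp E j')"
  then obtain src C b C' b' where
    j: "nd E j = p" "inp E j = Recv src (MEcho C b p)" and
    j': "nd E j' = p" "inp E j' = Recv src (MEcho C' b' p)"
    unfolding echo_receipts_def by auto
  from echo_origin[OF j(2)] obtain i ie where
    i: "nd E i = src" "dl E j = (i, 0)" "inp E i = Recv p (MEnter p)" "nd E ie = p"
      "inp E ie = SigEnter" "dl E i = (ie, 0)" .
  from echo_origin[OF j'(2)] obtain i' ie' where
    i': "nd E i' = src" "dl E j' = (i', 0)" "inp E i' = Recv p (MEnter p)" "nd E ie' = p"
      "inp E ie' = SigEnter" "dl E i' = (ie', 0)" .
  have "ie = ie'" by (rule enter_unique) (simp_all add: i i')
  then have "i = i'" using receipt_unique[OF i(3) i'(3)] i i' by simp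
  then show "j = j'" using receipt_unique[OF j(2) j'(2)] j j' i i' by simp
qed

section \<open>Activity in real time and timely delivery\<close>

lemma entered_mono: "entered E q t \<Longrightarrow> t \<le> u \<Longrightarrow> entered E q u"
  unfolding entered_def by (metis order_trans)

lemma active_earlier: "active E q u \<Longrightarrow> entered E q t \<Longrightarrow> t \<le> u \<Longrightarrow> active E q t"
  unfolding active_def present_def has_left_def crashed_def by (metis order_trans)

text \<open>Passes from step order to real time. The inequality is strict because a departure or
  crash at the instant of step \<open>k\<close> may come after that step.\<close>

lemma active_before_imp_active:
  assumes "active_before E q k" "entered E q t" "t < tm E k"
  shows "active E q t"
  using assms unfolding active_before_def active_def present_def has_left_def crashed_before_def
    crashed_def by (auto dest!: order_le_less_trans[OF _ assms(3)] tm_less_imp_less)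

lemma enter_imp_entered: "inp E i = SigEnter \<Longrightarrow> tm E i \<le> t \<Longrightarrow> entered E (nd E i) t"
  unfolding entered_def by blast

lemma entered_before_imp_entered: "entered_before E q k \<Longrightarrow> k \<le> Suc j \<Longrightarrow> entered E q (tm E j)"
  unfolding entered_before_def entered_def by (auto intro!: tm_mono)

text \<open>If the receipt were late, the receiver would have been active throughout the delivery
  period and would have received the message in time as well, hence twice. A node that enters only
  after the broadcast may receive it arbitrarily late.\<close>

lemma receipt_within_D:
  assumes "inp E j = Recv src m" "dl E j = (i, 0)" "out \<gamma> E i = [m]"
    and "entered E (nd E j) (tm E i)"
  shows "tm E j \<le> tm E i + D"
proof (rule ccontr)
  assume late: "\<not> tm E j \<le> tm E i + D"
  have "active_before E (nd E j) j" by (rule step_active) (auto simp: assms)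
  have "nd E i \<noteq> nd E j" using receipts_sent assms(1,2) by (metis fst_conv)
  moreover have "active E (nd E j) t" if "tm E i \<le> t" "t \<le> tm E i + D" for t
    using active_before_imp_active[OF \<open>active_before E (nd E j) j\<close>] entered_mono[OF assms(4)] that late
    by auto
  ultimately obtain j' where "nd E j' = nd E j" "inp E j' = Recv (nd E i) m" "dl E j' = (i, 0)"
    "tm E j' \<le> tm E i + D"
    using delivery[OF assms(3), of "nd E j"] by metis
  with late receipt_unique[OF this(2) assms(1)] assms(2) show False by auto
qed

end

subsection \<open>Churn and failures\<close>

locale ccreg_bounded = ccreg E \<gamma> D for E :: "'n execution" and \<gamma> D +
  fixes \<alpha> \<Delta> :: real and Nmin :: nat
  assumes alpha_nonneg: "0 \<le> \<alpha>" and alpha_less_1: "\<alpha> < 1"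
    and Delta_nonneg: "0 \<le> \<Delta>"
    and Nmin_large: "1 < ((1 - \<alpha>)^3 - \<Delta> * (1 + \<alpha>)^3) * real Nmin"
    and gamma_lower:
      "\<gamma> \<ge> 1 / (real Nmin * (1 - \<alpha>)^3) + (1 + \<Delta>) * ((1 + \<alpha>)^3 / (1 - \<alpha>)^3) - 1"
    and gamma_upper: "\<gamma> \<le> (1 - \<alpha>)^3 / (1 + \<alpha>)^3 - \<Delta>"
    and population: "\<forall>t\<ge>0. Npres E t \<ge> Nmin"
    and churn: "churn_ok \<alpha> D E"
    and failures: "failures_ok \<Delta> E"
begin

abbreviation N :: "real \<Rightarrow> real" where
  "N t \<equiv> real (Npres E t)"

definition churned :: "real \<Rightarrow> real \<Rightarrow> 'n set" where
  "churned t u = {q. \<exists>i. (nd E i = q \<and> inp E i = SigEnter \<or> inp E i = SigLeave q)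
                        \<and> t \<le> tm E i \<and> tm E i \<le> u}"

section \<open>Consequences of the parameter constraints\<close>

lemma Nmin_pos: "0 < Nmin"
  using Nmin_large by (cases Nmin) auto

lemma N_ge_Nmin: "0 \<le> t \<Longrightarrow> real Nmin \<le> N t"
  using population by simp

lemma N_pos: "0 \<le> t \<Longrightarrow> 0 < N t"
  using N_ge_Nmin[of t] Nmin_pos by linarith

lemma gamma_lower':
  "1 / real Nmin + (1 + \<Delta>) * (1 + \<alpha>)^3 - (1 - \<alpha>)^3 \<le> \<gamma> * (1 - \<alpha>)^3"
proof -
  have b: "0 < (1 - \<alpha>)^3" using alpha_less_1 by simp
  have "(1 / (real Nmin * (1 - \<alpha>)^3) + (1 + \<Delta>) * ((1 + \<alpha>)^3 / (1 - \<alpha>)^3) - 1) * (1 - \<alpha>)^3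
      \<le> \<gamma> * (1 - \<alpha>)^3"
    using gamma_lower b by (intro mult_right_mono) auto
  moreover have "(1 / (real Nmin * (1 - \<alpha>)^3) + (1 + \<Delta>) * ((1 + \<alpha>)^3 / (1 - \<alpha>)^3) - 1) * (1 - \<alpha>)^3
      = 1 / real Nmin + (1 + \<Delta>) * (1 + \<alpha>)^3 - (1 - \<alpha>)^3"
    using b Nmin_pos by (simp add: field_simps)
  ultimately show ?thesis by simp
qed

lemma gamma_lower_strict:
  "(1 + \<alpha>)^3 + \<Delta> * (1 + \<alpha>)^3 < (1 - \<alpha>)^3 + \<gamma> * (1 - \<alpha>)^3"
proof -
  have "0 < 1 / real Nmin" using Nmin_pos by simp
  moreover have "(1 + \<Delta>) * (1 + \<alpha>)^3 = (1 + \<alpha>)^3 + \<Delta> * (1 + \<alpha>)^3" by (simp add: distrib_right)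
  ultimately show ?thesis using gamma_lower' by linarith
qed

lemma gamma_upper': "\<gamma> * (1 + \<alpha>)^3 \<le> (1 - \<alpha>)^3 - \<Delta> * (1 + \<alpha>)^3"
proof -
  have a: "0 < (1 + \<alpha>)^3" using alpha_nonneg by simp
  have "\<gamma> * (1 + \<alpha>)^3 \<le> ((1 - \<alpha>)^3 / (1 + \<alpha>)^3 - \<Delta>) * (1 + \<alpha>)^3"
    using gamma_upper a by (intro mult_right_mono) auto
  with a show ?thesis by (simp add: left_diff_distrib)
qed

lemma cube_mono: "(1 - \<alpha>)^3 \<le> (1 + \<alpha>)^3"
  using alpha_nonneg alpha_less_1 by (intro power_mono) auto

lemma cube_le_1: "(1 - \<alpha>)^3 \<le> 1"
  using alpha_nonneg alpha_less_1 by (intro power_le_one) auto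

lemma cube_ge_1: "1 \<le> (1 + \<alpha>)^3"
  using alpha_nonneg by (intro one_le_power) auto

lemma gamma_pos: "0 < \<gamma>"
proof -
  have "0 \<le> \<Delta> * (1 + \<alpha>)^3"
    using Delta_nonneg alpha_nonneg by simp
  then have "0 < \<gamma> * (1 - \<alpha>)^3"
    using gamma_lower_strict cube_mono by linarith
  with alpha_less_1 show ?thesis by (simp add: zero_less_mult_iff)
qed

text \<open>Leaves room for a node untouched by churn and crashes, see
  \<open>long_lived_node_exists\<close>. The lower bound on \<gamma> puts the left side below
  \<open>(1 + \<gamma>) * (1 - \<alpha>)^3\<close>, and the upper bound gives
  \<open>\<gamma> \<le> 1\<close>.\<close>

lemma expanded_population_small: "(1 + \<Delta>) * (1 + \<alpha>)^3 < 2"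
proof -
  have "(1 + \<Delta>) * (1 + \<alpha>)^3 < (1 + \<gamma>) * (1 - \<alpha>)^3"
    using gamma_lower_strict by (simp add: distrib_right)
  also have "\<dots> \<le> 2"
  proof -
    have "\<gamma> * 1 \<le> \<gamma> * (1 + \<alpha>)^3" using gamma_pos cube_ge_1 by (intro mult_left_mono) auto
    also have "\<dots> \<le> 1"
      using gamma_upper' Delta_nonneg cube_ge_1 cube_le_1
      by (smt (verit) mult_nonneg_nonneg)
    finally have "(1 + \<gamma>) * (1 - \<alpha>)^3 \<le> 2 * 1"
      using cube_le_1 alpha_less_1 gamma_pos by (intro mult_mono) auto
    then show ?thesis by simp
  qed
  finally show ?thesis .
qed

text \<open>The two constraints on \<open>\<gamma>\<close> are compatible only for small churn: they force
  \<open>r - 1 < 1 / r\<close> for \<open>r = ((1 + \<alpha>) / (1 - \<alpha>))\<^sup>3\<close>.\<close>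

lemma alpha_less_tenth: "\<alpha> < 1 / 10"
proof (rule ccontr)
  assume "\<not> \<alpha> < 1 / 10"
  then have a: "(11/10)^3 \<le> (1 + \<alpha>)^3" and b: "(1 - \<alpha>)^3 \<le> (9/10)^3"
    using alpha_less_1 by (intro power_mono; simp)+
  have "0 \<le> \<Delta> * (1 + \<alpha>)^3"
    using Delta_nonneg alpha_nonneg by simp
  then have 1: "(1 + \<alpha>)^3 < (1 + \<gamma>) * (1 - \<alpha>)^3" and 2: "\<gamma> * (1 + \<alpha>)^3 \<le> (1 - \<alpha>)^3"
    using gamma_lower_strict gamma_upper' by (simp_all add: distrib_right)
  have "(1 + \<gamma>) * (1 - \<alpha>)^3 \<le> (1 + \<gamma>) * (9/10)^3" using b gamma_pos by (intro mult_left_mono) auto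
  with 1 a have "(11/10)^3 < (1 + \<gamma>) * (9/10)^3" by linarith
  moreover have "\<gamma> * (11/10)^3 \<le> \<gamma> * (1 + \<alpha>)^3" using a gamma_pos by (intro mult_left_mono) auto
  with 2 b have "\<gamma> * (11/10)^3 \<le> (9/10)^3" by linarith
  \<comment> \<open>The first inequality forces \<open>\<gamma> > 0.82\<close>, the second
    \<open>\<gamma> < 0.55\<close>.\<close>
  ultimately show False by (simp add: power3_eq_cube)
qed

text \<open>The lower bound on \<gamma> yields \<open>\<Delta> < \<gamma>\<close>, the upper bound
  \<open>\<gamma> + \<Delta> \<le> 1\<close>.\<close>

lemma Delta_less_half: "\<Delta> < 1 / 2"
proof -
  have a: "0 < (1 + \<alpha>)^3" and b: "0 < (1 - \<alpha>)^3" using alpha_nonneg alpha_less_1 by auto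
  have "\<Delta> * (1 - \<alpha>)^3 \<le> \<Delta> * (1 + \<alpha>)^3"
    using cube_mono Delta_nonneg by (rule mult_left_mono)
  with gamma_lower_strict cube_mono have "\<Delta> * (1 - \<alpha>)^3 < \<gamma> * (1 - \<alpha>)^3" by linarith
  with b have "\<Delta> < \<gamma>" by simp
  have "(\<gamma> + \<Delta>) * (1 + \<alpha>)^3 \<le> 1 * (1 + \<alpha>)^3"
    using gamma_upper' cube_mono by (simp add: distrib_right)
  with a have "\<gamma> + \<Delta> \<le> 1" by simp
  with \<open>\<Delta> < \<gamma>\<close> show ?thesis by simp
qed

text \<open>The count behind \<open>knows_step\<close>, relative to the population: on the left the
  nodes that churn within \<open>4 * D\<close> or crash, on the right a lower bound for the join
  threshold. Multiplying by \<open>(1 - \<alpha>)^3\<close> and inserting the lower bound on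
  \<gamma> leaves a polynomial inequality in \<alpha> and \<Delta>.\<close>

lemma churn_crash_below_threshold:
  "(1 + \<alpha>)^4 - 1 + \<Delta> * (1 + \<alpha>)^3 < \<gamma> * (2 - (1 + \<alpha>)^3)"
proof -
  let ?a = "(1 + \<alpha>)^3" and ?b = "(1 - \<alpha>)^3"
  have b: "0 < ?b" using alpha_less_1 by simp
  have "?a \<le> (1 + \<Delta>) * ?a" using Delta_nonneg alpha_nonneg by (simp add: distrib_right)
  with expanded_population_small have a2: "0 < 2 - ?a" by linarith
  \<comment> \<open>What remains for \<open>\<Delta> = 1 / 2\<close> once a factor \<alpha> is split
    off. The constant 2 dominates for \<open>\<alpha> < 1 / 10\<close>.\<close>
  have "0 \<le> 2 - 15 * \<alpha> - 23 * \<alpha>^2 - 24 * \<alpha>^3 - 12 * \<alpha>^4 - \<alpha>^5 + \<alpha>^6"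
  proof -
    have "\<alpha>^n \<le> (1/10)^n" "0 \<le> \<alpha>^n" for n
      using alpha_nonneg alpha_less_tenth by (auto intro: power_mono)
    from this[of 1] this[of 2] this[of 3] this[of 4] this[of 5] this[of 6] show ?thesis
      by (simp add: power_divide)
  qed
  then have "0 \<le> \<alpha> * (2 - 15 * \<alpha> - 23 * \<alpha>^2 - 24 * \<alpha>^3 - 12 * \<alpha>^4 - \<alpha>^5 + \<alpha>^6)"
    using alpha_nonneg by simp
  also have "\<dots> = (2 - ?a) * (?a - ?b) - ?b * ((1 + \<alpha>)^4 - 1) - 3 * \<alpha>^2 * ?a"
    by algebra
  \<comment> \<open>\<Delta> contributes \<open>\<Delta> * ?a * (2 - ?a - ?b)\<close>, where
    \<open>?a + ?b = 2 + 6 * \<alpha>^2\<close>. Its worst value is bounded by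
    \<open>\<Delta> < 1 / 2\<close>.\<close>
  also have "\<dots> \<le> (2 - ?a) * (?a - ?b) - ?b * ((1 + \<alpha>)^4 - 1) - 6 * \<Delta> * \<alpha>^2 * ?a"
  proof -
    have "6 * \<Delta> * (\<alpha>^2 * ?a) \<le> 3 * (\<alpha>^2 * ?a)"
      using Delta_less_half alpha_nonneg by (intro mult_right_mono) auto
    then show ?thesis by (simp add: mult.assoc)
  qed
  also have "\<dots> = (2 - ?a) * (?a + \<Delta> * ?a - ?b) - ?b * ((1 + \<alpha>)^4 - 1 + \<Delta> * ?a)"
    by algebra
  finally have "?b * ((1 + \<alpha>)^4 - 1 + \<Delta> * ?a) \<le> (2 - ?a) * (?a + \<Delta> * ?a - ?b)"
    by simp
  also have "\<dots> < (2 - ?a) * (\<gamma> * ?b)"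
    using gamma_lower_strict a2 by (intro mult_strict_left_mono) auto
  finally have "?b * ((1 + \<alpha>)^4 - 1 + \<Delta> * ?a) < ?b * (\<gamma> * (2 - ?a))"
    by (simp add: ac_simps)
  with b show ?thesis by (simp only: mult_less_cancel_left_pos)
qed

section \<open>Churn and population over several periods\<close>

lemma churned_D:
  assumes "0 \<le> t"
  shows "finite (churned t (t + D))" "real (card (churned t (t + D))) \<le> \<alpha> * N t"
  using churn assms unfolding churn_ok_def churned_def Let_def by auto

lemma present_later:
  assumes "t \<le> u"
  shows "{q. present E q u} \<subseteq> {q. present E q t} \<union> churned t u"
proof
  fix q assume q: "q \<in> {q. present E q u}"
  then have "\<not> has_left E q t"
    using assms unfolding present_def has_left_def by (auto dest: order_trans[OF _ assms])
  with q show "q \<in> {q. present E q t} \<union> churned t u"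
    unfolding present_def entered_def churned_def by (auto, metis linear)
qed

lemma N_grows:
  assumes "0 \<le> t"
  shows "N (t + D) \<le> (1 + \<alpha>) * N t"
proof -
  have "card {q. present E q (t + D)} \<le> card ({q. present E q t} \<union> churned t (t + D))"
    using present_later[of t "t + D"] D_pos churned_D(1)[OF assms] finite_present[OF assms] by (intro card_mono) auto
  also have "\<dots> \<le> Npres E t + card (churned t (t + D))"
    unfolding Npres_def by (rule card_Un_le)
  finally have "N (t + D) \<le> N t + real (card (churned t (t + D)))"
    unfolding Npres_def by linarith
  with churned_D(2)[OF assms] show ?thesis by (simp add: distrib_right)
qed

lemma churned_split: "churned t u \<subseteq> churned t v \<union> churned v u"
  unfolding churned_def by force

text \<open>The churn of each period is measured against a population that may have grown by the
  factor \<open>1 + \<alpha>\<close> in every earlier one. Counting starts at one period: for none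
  the bound would be 0, yet the closed interval may contain events at time \<open>t\<close>.\<close>

lemma churned_periods:
  assumes "0 \<le> t"
  shows "finite (churned t (t + real (Suc n) * D)) \<and>
    real (card (churned t (t + real (Suc n) * D))) \<le> ((1 + \<alpha>)^Suc n - 1) * N t"
  using assms
proof (induction n arbitrary: t)
  case 0
  then show ?case using churned_D[OF 0] by simp
next
  case (Suc n)
  let ?u = "t + real (Suc (Suc n)) * D"
  have t': "0 \<le> t + D" using Suc.prems D_pos by simp
  have eq: "t + D + real (Suc n) * D = ?u" by (simp add: algebra_simps)
  note IH = Suc.IH[OF t', unfolded eq]
  have fin: "finite (churned t (t + D) \<union> churned (t + D) ?u)"
    using IH churned_D(1)[OF Suc.prems] by simp
  have "real (card (churned t ?u)) \<le> real (card (churned t (t + D) \<union> churned (t + D) ?u))"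
    using churned_split fin by (simp add: card_mono)
  also have "\<dots> \<le> real (card (churned t (t + D))) + real (card (churned (t + D) ?u))"
    using card_Un_le[of "churned t (t + D)" "churned (t + D) ?u"] by linarith
  also have "\<dots> \<le> \<alpha> * N t + ((1 + \<alpha>)^Suc n - 1) * N (t + D)"
    using IH churned_D(2)[OF Suc.prems] by simp
  also have "\<dots> \<le> \<alpha> * N t + ((1 + \<alpha>)^Suc n - 1) * ((1 + \<alpha>) * N t)"
    using N_grows[OF Suc.prems] alpha_nonneg
    by (intro add_left_mono mult_left_mono) (auto simp: one_le_power simp del: power_Suc)
  also have "\<dots> = ((1 + \<alpha>)^Suc (Suc n) - 1) * N t"
    by (simp add: algebra_simps)
  finally show ?case using finite_subset[OF churned_split fin] by simp
qed

lemma churned_3D: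
  assumes "0 \<le> t"
  shows "finite (churned t (t + 3 * D))" "real (card (churned t (t + 3 * D))) \<le> ((1 + \<alpha>)^3 - 1) * N t"
  using churned_periods[OF assms, of 2] by (simp_all add: eval_nat_numeral)

lemma churned_4D:
  assumes "0 \<le> t"
  shows "finite (churned t (t + 4 * D))" "real (card (churned t (t + 4 * D))) \<le> ((1 + \<alpha>)^4 - 1) * N t"
  using churned_periods[OF assms, of 3] by (simp_all add: eval_nat_numeral)

text \<open>Such a node is present at \<open>t\<close> or churns within the period; a departure at
  exactly \<open>t\<close> counts as churn. The set is arbitrary so that the bound covers true
  populations as well as the sets that nodes believe present.\<close>

lemma entered_unless_left_3D:
  assumes t: "0 \<le> t"
    and A: "\<And>q. q \<in> A \<Longrightarrow> entered E q (t + 3 * D) \<and> \<not> (\<exists>i. inp E i = SigLeave q \<and> tm E i < t)"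
  shows "finite A" "real (card A) \<le> (1 + \<alpha>)^3 * N t"
proof -
  have sub: "A \<subseteq> {q. present E q t} \<union> churned t (t + 3 * D)"
    using A D_pos unfolding present_def entered_def has_left_def churned_def by force
  have fin: "finite ({q. present E q t} \<union> churned t (t + 3 * D))"
    using churned_3D(1)[OF t] finite_present[OF t] by simp
  show "finite A" using sub fin by (rule finite_subset)
  have "card A \<le> card {q. present E q t} + card (churned t (t + 3 * D))"
    using card_mono[OF fin sub] card_Un_le order_trans by blast
  then have "real (card A) \<le> N t + real (card (churned t (t + 3 * D)))"
    unfolding Npres_def by linarith
  with churned_3D(2)[OF t] show "real (card A) \<le> (1 + \<alpha>)^3 * N t"
    by (simp add: left_diff_distrib)
qed

lemma N_3D:
  assumes t: "0 \<le> t" and u: "t \<le> u" "u \<le> t + 3 * D"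
  shows "N u \<le> (1 + \<alpha>)^3 * N t"
  unfolding Npres_def[of E u]
proof (rule entered_unless_left_3D(2)[OF t])
  fix q assume "q \<in> {q. present E q u}"
  then show "entered E q (t + 3 * D) \<and> \<not> (\<exists>i. inp E i = SigLeave q \<and> tm E i < t)"
    using entered_mono[of q u] u unfolding present_def has_left_def by force
qed

section \<open>Departures and survivors\<close>

definition leavers :: "real \<Rightarrow> real \<Rightarrow> 'n set" where
  "leavers t u = {q. present E q t \<and> has_left E q u}"

lemma leavers_mono: "u \<le> v \<Longrightarrow> leavers t u \<subseteq> leavers t v"
  unfolding leavers_def has_left_def by force

lemma leavers_churned: "leavers t u \<subseteq> churned t u"
  unfolding leavers_def present_def has_left_def churned_def by force

lemma finite_leavers: "0 \<le> t \<Longrightarrow> finite (leavers t u)"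
  using finite_present[of t] unfolding leavers_def by simp

text \<open>The factor 2 arises because a departure both removes a node and uses up churn that could
  have been an enter.\<close>

lemma leavers_D:
  assumes t: "0 \<le> t"
  shows "real (card (leavers t (t + D))) \<le> \<alpha> * N t"
    and "N (t + D) \<le> (1 + \<alpha>) * N t - 2 * real (card (leavers t (t + D)))"
proof -
  let ?X = "leavers t (t + D)" and ?C = "churned t (t + D)" and ?S = "{q. present E q t}"
  have fin: "finite ?S" "finite ?C" "finite ?X"
    using churned_D(1)[OF t] finite_present[OF t] finite_leavers[OF t] by auto
  have XC: "?X \<subseteq> ?C" by (rule leavers_churned)
  have XS: "?X \<subseteq> ?S" unfolding leavers_def by auto
  have cX: "card ?X \<le> card ?C" "card ?X \<le> card ?S"
    using card_mono fin XC XS by blast+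
  then show "real (card ?X) \<le> \<alpha> * N t"
    using churned_D(2)[OF t] by linarith
  have "{q. present E q (t + D)} \<inter> ?X = {}"
    unfolding leavers_def present_def by auto
  then have "{q. present E q (t + D)} \<subseteq> (?S - ?X) \<union> (?C - ?X)"
    using present_later[of t "t + D"] D_pos by auto
  then have "card {q. present E q (t + D)} \<le> card ((?S - ?X) \<union> (?C - ?X))"
    using fin by (intro card_mono) auto
  also have "\<dots> \<le> (card ?S - card ?X) + (card ?C - card ?X)"
    using card_Un_le[of "?S - ?X" "?C - ?X"] card_Diff_subset[OF fin(3) XS]
      card_Diff_subset[OF fin(3) XC] by simp
  finally have "N (t + D) \<le> N t + real (card ?C) - 2 * real (card ?X)"
    using cX unfolding Npres_def by linarith
  with churned_D(2)[OF t] show "N (t + D) \<le> (1 + \<alpha>) * N t - 2 * real (card ?X)"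
    by (simp add: distrib_right)
qed

text \<open>Churn counts nodes that enter as well as nodes that leave, so a period that enlarges the
  population loses fewer nodes.  As long as at most half the population leaves in \<open>n\<close> periods,
  it is worst for survival that all churn consists of departures.\<close>

lemma leavers_periods_Suc:
  assumes c: "0 \<le> c" "c \<le> 1 / 2"
    and IH: "\<And>t. 0 \<le> t \<Longrightarrow> real (card (leavers t (t + x))) \<le> c * N t"
    and t: "0 \<le> t"
  shows "real (card (leavers t (t + (D + x)))) \<le> (1 - (1 - \<alpha>) * (1 - c)) * N t"
proof -
  have t': "0 \<le> t + D" using t D_pos by simp
  let ?X = "leavers t (t + D)" and ?Y = "leavers (t + D) (t + D + x)"
  have "leavers t (t + (D + x)) \<subseteq> ?X \<union> ?Y"
    unfolding leavers_def present_def using entered_mono[of _ t "t + D"] D_pos by (auto simp: add.assoc)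
  then have "card (leavers t (t + (D + x))) \<le> card (?X \<union> ?Y)"
    using finite_leavers t t' by (intro card_mono) auto
  also have "\<dots> \<le> card ?X + card ?Y" by (rule card_Un_le)
  finally have "real (card (leavers t (t + (D + x)))) \<le> real (card ?X) + real (card ?Y)" by linarith
  also have "\<dots> \<le> real (card ?X) + c * N (t + D)"
    using IH[OF t'] by simp
  also have "\<dots> \<le> real (card ?X) + c * ((1 + \<alpha>) * N t - 2 * real (card ?X))"
    using leavers_D(2)[OF t] c by (intro add_left_mono mult_left_mono) auto
  also have "\<dots> = (1 - 2 * c) * real (card ?X) + c * (1 + \<alpha>) * N t"
    by (simp add: algebra_simps)
  also have "\<dots> \<le> (1 - 2 * c) * (\<alpha> * N t) + c * (1 + \<alpha>) * N t"
    using leavers_D(1)[OF t] c by (intro add_right_mono mult_left_mono) auto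
  also have "\<dots> = (1 - (1 - \<alpha>) * (1 - c)) * N t"
    by (simp add: algebra_simps)
  finally show ?thesis .
qed

lemma leavers_3D:
  assumes t: "0 \<le> t" and u: "u \<le> t + 3 * D"
  shows "real (card (leavers t u)) \<le> (1 - (1 - \<alpha>)^3) * N t"
proof -
  have 1: "real (card (leavers t (t + D))) \<le> \<alpha> * N t" if "0 \<le> t" for t
    by (rule leavers_D(1)[OF that])
  have 2: "real (card (leavers t (t + (D + D)))) \<le> (1 - (1 - \<alpha>)^2) * N t" if "0 \<le> t" for t
    using leavers_periods_Suc[OF alpha_nonneg _ 1 that] alpha_less_tenth
    by (simp add: power2_eq_square)
  have "0 \<le> 1 - (1 - \<alpha>)^2" "1 - (1 - \<alpha>)^2 \<le> 1 / 2"
    using alpha_nonneg alpha_less_tenth power_mono[of "9/10" "1 - \<alpha>" 2]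
      power_le_one[of "1 - \<alpha>" 2] by (auto simp: power2_eq_square)
  from leavers_periods_Suc[OF this 2 t]
  have "real (card (leavers t (t + 3 * D))) \<le> (1 - (1 - \<alpha>)^3) * N t"
    by (simp add: power2_eq_square power3_eq_cube mult.assoc)
  moreover have "card (leavers t u) \<le> card (leavers t (t + 3 * D))"
    using leavers_mono[OF u] finite_leavers[OF t] by (intro card_mono) auto
  ultimately show ?thesis by linarith
qed

lemma crashed_bound: "0 \<le> t \<Longrightarrow> real (card {q. present E q t \<and> crashed E q t}) \<le> \<Delta> * N t"
  using failures unfolding failures_ok_def by blast

text \<open>A node present at \<open>t\<close> but not active at \<open>u\<close> has left, or is
  present and crashed at \<open>u\<close>. Crashes are bounded by the population at
  \<open>u\<close>, hence the factor \<open>(1 + \<alpha>)^3\<close> next to \<Delta>.\<close>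

lemma active_survivors:
  assumes t: "0 \<le> t" and u: "t \<le> u" "u \<le> t + 3 * D"
  shows "((1 - \<alpha>)^3 - \<Delta> * (1 + \<alpha>)^3) * N t \<le> real (card {q. present E q t \<and> active E q u})"
proof -
  let ?S = "{q. present E q t}" and ?K = "{q. present E q u \<and> crashed E q u}"
    and ?G = "{q. present E q t \<and> active E q u}"
  have "?S \<subseteq> ?G \<union> leavers t u \<union> ?K"
    unfolding active_def present_def leavers_def using entered_mono u by blast
  then have "card ?S \<le> card (?G \<union> leavers t u \<union> ?K)"
    using finite_present[of t] finite_present[of u] finite_leavers[of t u] t u
    by (intro card_mono) auto
  also have "\<dots> \<le> card ?G + card (leavers t u) + card ?K"
    using card_Un_le[of ?G "leavers t u"] card_Un_le[of "?G \<union> leavers t u" ?K] by linarith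
  finally have "N t \<le> real (card ?G) + real (card (leavers t u)) + real (card ?K)"
    unfolding Npres_def by linarith
  also have "\<dots> \<le> real (card ?G) + (1 - (1 - \<alpha>)^3) * N t + \<Delta> * ((1 + \<alpha>)^3 * N t)"
  proof -
    have "real (card ?K) \<le> \<Delta> * N u" using crashed_bound t u by simp
    also have "\<dots> \<le> \<Delta> * ((1 + \<alpha>)^3 * N t)"
      using N_3D[OF t u] Delta_nonneg by (intro mult_left_mono)
    finally show ?thesis using leavers_3D[OF t u(2)] by simp
  qed
  finally show ?thesis by (simp add: algebra_simps)
qed

subsection \<open>Knowledge of joined nodes\<close>

text \<open>The inequality is strict because steps at the same instant may come in either order.\<close>

definition knows :: "nat \<Rightarrow> 'n \<Rightarrow> bool" where
  "knows k p \<longleftrightarrow> Ent ` S0 E \<subseteq> changes (st k p) \<and>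
     (\<forall>i e. event E i e \<longrightarrow> tm E i + 2 * D < tm E k \<longrightarrow> e \<in> changes (st k p))"

lemma echo_receipt_origin:
  assumes ie: "inp E ie = SigEnter" "nd E ie = p" and j: "j \<in> echo_receipts E p k"
  obtains i where "ie < i" "i < j" "nd E i \<noteq> p" "recv_src (inp E j) = nd E i"
    "inp E i = Recv p (MEnter p)" "dl E i = (ie, 0)" "tm E j \<le> tm E i + D"
    "changes (st (Suc i) (nd E i)) \<subseteq> changes (st (Suc j) p)"
    "\<And>k. j \<in> joined_echo_receipts E p k \<Longrightarrow> is_joined (st i (nd E i))"
proof -
  from j obtain src C b where j': "nd E j = p" "inp E j = Recv src (MEcho C b p)"
    unfolding echo_receipts_def by blast
  from echo_origin[OF j'(2)] obtain i ie' where
    i: "i < j" "nd E i = src" "src \<noteq> nd E j" "out \<gamma> E i = [MEcho C b p]"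
      "dl E j = (i, 0)" "inp E i = Recv p (MEnter p)" "C = changes (st (Suc i) src)"
      "b = is_joined (st i src)" "ie' < i" "nd E ie' = p" "inp E ie' = SigEnter" "dl E i = (ie', 0)" .
  have "ie' = ie" by (rule enter_unique) (simp_all add: i ie)
  have "entered E p (tm E i)"
    using enter_imp_entered[OF ie(1)] ie(2) tm_mono[of ie i] i(9) \<open>ie' = ie\<close> by auto
  then have "tm E j \<le> tm E i + D"
    using receipt_within_D[OF j'(2) i(5) i(4)] j'(1) by simp
  moreover have "changes (st (Suc i) (nd E i)) \<subseteq> changes (st (Suc j) p)"
    using carried_in_changes[OF j'(2), of _ "Suc j"] i(2,7) j'(1) by auto
  moreover have "is_joined (st i (nd E i))" if "j \<in> joined_echo_receipts E p k" for k
    using that j' i(2,8) unfolding joined_echo_receipts_def by auto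
  ultimately show thesis
    using that[of i] i j' \<open>ie' = ie\<close> by simp
qed

lemma joined_echo_receipts_subset: "joined_echo_receipts E p k \<subseteq> echo_receipts E p k"
  unfolding joined_echo_receipts_def echo_receipts_def by blast

text \<open>Soundness limits the set to nodes that entered by \<open>s + 3 * D\<close>, and the
  merged knowledge removes those that left before \<open>s\<close>. For \<open>s = 0\<close> there
  are none of the latter.\<close>

lemma informed_present_set_upper:
  assumes kn: "knows i q" "changes (st i q) \<subseteq> changes (st (Suc j) p)"
    and s: "0 \<le> s" "s = 0 \<or> s \<le> tm E i - 2 * D" "tm E j \<le> s + 3 * D"
  shows "finite (present_set (changes (st (Suc j) p)))"
    and "real (card (present_set (changes (st (Suc j) p)))) \<le> (1 + \<alpha>)^3 * N s"
proof -
  have *: "entered E r (s + 3 * D) \<and> \<not> (\<exists>l. inp E l = SigLeave r \<and> tm E l < s)"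
    if r: "r \<in> present_set (changes (st (Suc j) p))" for r
  proof
    have "entered_before E r (Suc j)"
      using r changes_occurred[of "Ent r" "Suc j" p] unfolding present_set_def by simp
    then have "entered E r (tm E j)" by (rule entered_before_imp_entered) simp
    then show "entered E r (s + 3 * D)" using s(3) by (rule entered_mono)
    show "\<not> (\<exists>l. inp E l = SigLeave r \<and> tm E l < s)"
    proof
      assume "\<exists>l. inp E l = SigLeave r \<and> tm E l < s"
      then obtain l where l: "inp E l = SigLeave r" "tm E l < s" by blast
      with tm_nonneg[of l] s(2) have "tm E l + 2 * D < tm E i" by auto
      moreover have "event E l (Lv r)" using l by (simp add: event_def)
      ultimately have "Lv r \<in> changes (st (Suc j) p)" using kn unfolding knows_def by blast
      with r show False by (simp add: present_set_def)
    qed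
  qed
  show "finite (present_set (changes (st (Suc j) p)))"
    "real (card (present_set (changes (st (Suc j) p)))) \<le> (1 + \<alpha>)^3 * N s"
    using entered_unless_left_3D[OF s(1) *] by blast+
qed

text \<open>A node present at \<open>s\<close> without churn up to \<open>s + 3 * D\<close> is in
  the set: it belongs to \<open>S0\<close> or entered strictly before \<open>s\<close>, so its enter
  is known, and by soundness a recorded departure would be churn in that window.\<close>

lemma informed_present_set_lower:
  assumes kn: "knows i q" "changes (st i q) \<subseteq> changes (st (Suc j) p)"
    and s: "s = max 0 (tm E i - 2 * D)" "tm E j \<le> s + 3 * D"
  shows "(2 - (1 + \<alpha>)^3) * N s \<le> real (card (present_set (changes (st (Suc j) p))))"
proof -
  have s0: "0 \<le> s" using s by simp
  have fin: "finite (present_set (changes (st (Suc j) p)))"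
    using s by (intro informed_present_set_upper(1)[OF kn s0]) auto
  have sub: "{r. present E r s} - churned s (s + 3 * D) \<subseteq> present_set (changes (st (Suc j) p))"
  proof
    fix r assume r: "r \<in> {r. present E r s} - churned s (s + 3 * D)"
    have "Ent r \<in> changes (st (Suc j) p)"
    proof (cases "r \<in> S0 E")
      case True
      then show ?thesis using kn unfolding knows_def by blast
    next
      case False
      with r obtain l where l: "nd E l = r" "inp E l = SigEnter" "tm E l \<le> s"
        unfolding present_def entered_def by blast
      with r have "tm E l < s" using D_pos unfolding churned_def by force
      with tm_nonneg[of l] have "tm E l + 2 * D < tm E i" using s(1) by auto
      moreover have "event E l (Ent r)" using l by (simp add: event_def)
      ultimately show ?thesis using kn unfolding knows_def by blast
    qed
    moreover have "Lv r \<notin> changes (st (Suc j) p)"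
    proof
      assume "Lv r \<in> changes (st (Suc j) p)"
      then obtain l where l: "l < Suc j" "inp E l = SigLeave r"
        using changes_occurred by fastforce
      then have "tm E l \<le> s + 3 * D" using tm_mono[of l j] s(2) by simp
      with l r show False
        unfolding present_def has_left_def churned_def by (auto, metis linear)
    qed
    ultimately show "r \<in> present_set (changes (st (Suc j) p))" by (simp add: present_set_def)
  qed
  have "N s - real (card (churned s (s + 3 * D))) \<le> real (card ({r. present E r s} - churned s (s + 3 * D)))"
    using diff_card_le_card_Diff[OF churned_3D(1)[OF s0], of "{r. present E r s}"]
    unfolding Npres_def by linarith
  also have "\<dots> \<le> real (card (present_set (changes (st (Suc j) p))))"
    using card_mono[OF fin sub] by simp
  finally show ?thesis using churned_3D(2)[OF s0] by (simp add: left_diff_distrib)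
qed

section \<open>Joining within \<open>2 * D\<close>\<close>

lemma active_since_enter:
  assumes "inp E ie = SigEnter" "active E (nd E ie) T" "tm E ie \<le> t" "t \<le> T"
  shows "active E (nd E ie) t"
  using active_earlier[OF assms(2)] enter_imp_entered[OF assms(1,3)] assms(4) by blast

lemma echo_from_active:
  assumes ie: "inp E ie = SigEnter" "nd E ie = p" and act: "active E p (tm E ie + 2 * D)"
    and r: "r \<noteq> p" "entered E r (tm E ie)" "active E r (tm E ie + D)"
  obtains i j where "ie < i" "nd E i = r" "inp E i = Recv p (MEnter p)" "tm E i \<le> tm E ie + D"
    "nd E j = p" "tm E j \<le> tm E ie + 2 * D"
    "inp E j = Recv r (MEcho (changes (st (Suc i) r)) (is_joined (st i r)) p)"
proof -
  have "active E r t" if "tm E ie \<le> t" "t \<le> tm E ie + D" for t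
    using active_earlier[OF r(3)] entered_mono[OF r(2)] that by blast
  then obtain i where i: "ie < i" "nd E i = r" "inp E i = Recv p (MEnter p)" "tm E i \<le> tm E ie + D"
    using delivery[OF enter_broadcast[OF ie(1)], of r] r(1) ie(2) by metis
  have "active E p t" if "tm E i \<le> t" "t \<le> tm E i + D" for t
    using active_since_enter[OF ie(1), of "tm E ie + 2 * D" t] act ie(2) that i(4)
      tm_mono[of ie i] i(1) by auto
  then obtain j where "nd E j = p" "tm E j \<le> tm E i + D"
    "inp E j = Recv r (MEcho (changes (st (Suc i) r)) (is_joined (st i r)) p)"
    using delivery[OF enter_reply[OF i(3)], of p] r(1) i(2) by metis
  with i that show thesis by force
qed

lemma unchurned_not_left: "present E r s \<Longrightarrow> r \<notin> churned s u \<Longrightarrow> \<not> has_left E r u"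
  unfolding present_def has_left_def churned_def by (auto, metis linear)

text \<open>Supplies the joined node that answers a newcomer. Absence of churn also rules out an
  enter at exactly \<open>s\<close>, as the strict inequality in the induction hypothesis on joining
  requires.\<close>

lemma long_lived_node_exists:
  assumes s: "0 \<le> s"
  obtains r where "present E r s" "r \<notin> churned s (s + 3 * D)" "active E r (s + 3 * D)"
proof -
  let ?S = "{r. present E r s}" and ?C = "churned s (s + 3 * D)"
    and ?K = "{r. present E r (s + 3 * D) \<and> crashed E r (s + 3 * D)}"
  have u: "s \<le> s + 3 * D" using D_pos by simp
  have fin: "finite ?C" "finite ?K"
    using churned_3D(1)[OF s] finite_present[of "s + 3 * D"] s u by auto
  have "real (card (?C \<union> ?K)) \<le> real (card ?C) + real (card ?K)"
    using card_Un_le[of ?C ?K] by linarith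
  also have "\<dots> \<le> ((1 + \<alpha>)^3 - 1) * N s + \<Delta> * ((1 + \<alpha>)^3 * N s)"
    using churned_3D(2)[OF s] crashed_bound[of "s + 3 * D"] s u
      mult_left_mono[OF N_3D[OF s u order_refl] Delta_nonneg] by linarith
  also have "\<dots> = ((1 + \<Delta>) * (1 + \<alpha>)^3 - 1) * N s"
    by (simp add: algebra_simps)
  also have "\<dots> < 1 * N s"
    using expanded_population_small N_pos[OF s] by (intro mult_strict_right_mono) auto
  finally have "card (?C \<union> ?K) < card ?S" by (simp add: Npres_def)
  then obtain r where r: "present E r s" "r \<notin> ?C" "r \<notin> ?K"
    using card_mono[of "?C \<union> ?K" ?S] fin by (metis (no_types, lifting) UnCI finite_UnI leD mem_Collect_eq subsetI)
  then have "present E r (s + 3 * D)"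
    using unchurned_not_left[of r s "s + 3 * D"] entered_mono[OF _ u] unfolding present_def by blast
  with r that show thesis unfolding active_def by blast
qed

text \<open>\<open>IHT\<close> shows that the long-lived node has joined before it echoes,
  \<open>IHK\<close> that the sender of the echo fixing the bound is informed.\<close>

lemma joins_in_time_step:
  assumes IHK: "\<And>i q. i < k \<Longrightarrow> is_joined (st i q) \<Longrightarrow> active_before E q i \<Longrightarrow> knows i q"
    and IHT: "\<And>i ie. i < k \<Longrightarrow> inp E ie = SigEnter \<Longrightarrow> active E (nd E ie) (tm E ie + 2 * D) \<Longrightarrow>
        tm E ie + 2 * D < tm E i \<Longrightarrow> is_joined (st i (nd E ie))"
    and ie: "inp E ie = SigEnter" "nd E ie = p" and act: "active E p (tm E ie + 2 * D)"
    and k: "tm E ie + 2 * D < tm E k"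
  shows "is_joined (st k p)"
proof -
  define t0 where "t0 = tm E ie"
  \<comment> \<open>The first step after the deadline, so \<open>st K\<close> reflects exactly the
    steps up to \<open>t0 + 2 * D\<close>.\<close>
  define K where "K = (LEAST m. t0 + 2 * D < tm E m)"
  have K: "t0 + 2 * D < tm E K" "K \<le> k"
    using k unfolding K_def t0_def by (auto intro: LeastI Least_le)
  have less_K: "j < K \<longleftrightarrow> tm E j \<le> t0 + 2 * D" for j
    using not_less_Least[of j "\<lambda>m. t0 + 2 * D < tm E m"] K(1) tm_less_imp_less[of j K]
    unfolding K_def[symmetric] by force
  have t0: "0 < t0" using enter_time_pos[OF ie(1)] by (simp add: t0_def)
  have pS0: "p \<notin> S0 E" using enter_not_S0[OF ie(1)] ie(2) by simp
  have not_present_early: "\<not> entered E p t" if "t < t0" for t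
    using pS0 enter_unique[OF _ ie(1)] ie(2) that unfolding entered_def t0_def by force
  have "is_joined (st K p)"
  proof (rule ccontr)
    assume nj: "\<not> is_joined (st K p)"
    note inv = join_inv_holds[OF pS0, of \<gamma> K, unfolded join_inv_def Let_def]

    have "joined_echo_receipts E p K \<noteq> {}"
    proof -
      \<comment> \<open>Early enough that an unchurned node present at \<open>s\<close> has joined
        when it echoes, late enough that \<open>s + 3 * D\<close> reaches
        \<open>t0 + D\<close>.\<close>
      define s where "s = max 0 (t0 - 2 * D)"
      have s: "0 \<le> s" "s < t0" "t0 - 2 * D \<le> s" using t0 D_pos by (auto simp: s_def)
      obtain r where r: "present E r s" "r \<notin> churned s (s + 3 * D)" "active E r (s + 3 * D)"
        using long_lived_node_exists[OF s(1)] by blast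
      then have act_r: "active E r t" if "s \<le> t" "t \<le> t0 + D" for t
        using active_earlier[OF r(3), of t] entered_mono[of r s t] r(1) that s(3)
        unfolding present_def by auto
      have "r \<noteq> p" using not_present_early[OF s(2)] r(1) unfolding present_def by blast
      moreover have "entered E r (tm E ie)" "active E r (tm E ie + D)"
        using act_r[of t0] act_r[of "t0 + D"] s D_pos unfolding active_def present_def t0_def by auto
      ultimately obtain i j where i: "ie < i" "nd E i = r" "inp E i = Recv p (MEnter p)"
          "tm E i \<le> tm E ie + D" and
        j: "nd E j = p" "tm E j \<le> tm E ie + 2 * D"
          "inp E j = Recv r (MEcho (changes (st (Suc i) r)) (is_joined (st i r)) p)"
        using echo_from_active[OF ie act] by blast
      have "is_joined (st i r)"
      proof (cases "r \<in> S0 E")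
        case True
        then show ?thesis by (rule S0_joined)
      next
        case False
        with r(1) obtain l where l: "nd E l = r" "inp E l = SigEnter" "tm E l \<le> s"
          unfolding present_def entered_def by blast
        with r(2) have "tm E l < s" using D_pos unfolding churned_def by force
        then have "tm E l < t0 - 2 * D" using tm_nonneg[of l] by (auto simp: s_def)
        moreover have "t0 \<le> tm E i" using tm_mono[of ie i] i(1) by (simp add: t0_def)
        moreover have "active E r (tm E l + 2 * D)"
        proof (rule active_earlier)
          show "active E r t0" using act_r[of t0] s D_pos by simp
          show "entered E r (tm E l + 2 * D)"
            using enter_imp_entered[OF l(2)] l(1) D_pos by simp
        qed (use \<open>tm E l < t0 - 2 * D\<close> in simp)
        moreover have "i < k"
          using i(4) k D_pos by (intro tm_less_imp_less) linarith
        ultimately show ?thesis using IHT[of i l] l by simp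
      qed
      moreover have "j < K" using j(2) less_K by (simp add: t0_def)
      ultimately have "j \<in> joined_echo_receipts E p K"
        using j unfolding joined_echo_receipts_def by auto
      then show ?thesis by blast
    qed
    then obtain j where j: "j \<in> joined_echo_receipts E p K"
      and bound: "join_bound (st K p) = join_threshold \<gamma> E p j"
      using inv nj by blast
    have "j < K" using j unfolding joined_echo_receipts_def by blast
    have "j \<in> echo_receipts E p K" using j joined_echo_receipts_subset by blast
    from echo_receipt_origin[OF ie this] obtain i where
      i: "ie < i" "i < j" "nd E i \<noteq> p" "inp E i = Recv p (MEnter p)" "tm E j \<le> tm E i + D"
        "changes (st (Suc i) (nd E i)) \<subseteq> changes (st (Suc j) p)" "is_joined (st i (nd E i))"
      using j by metis
    have "active_before E (nd E i) i" by (rule step_active) (simp_all add: i)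
    then have kn: "knows i (nd E i)" using IHK[of i] i \<open>j < K\<close> K(2) by simp
    have ch: "changes (st i (nd E i)) \<subseteq> changes (st (Suc j) p)"
      using changes_mono[of i "Suc i"] i(6) by force
    have ti: "t0 \<le> tm E i" using tm_mono[of ie i] i(1) by (simp add: t0_def)
    have tj: "tm E j \<le> t0 + 2 * D" using less_K \<open>j < K\<close> by blast
    \<comment> \<open>\<open>t0 - D\<close> is only needed when the echo was sent at \<open>t0 + 2 * D\<close>: it keeps \<open>p\<close> out of the
      nodes present at \<open>s\<close>, since \<open>p\<close> does not echo its own message.\<close>
    define s where "s = max 0 (min (tm E i - 2 * D) (t0 - D))"
    have s: "0 \<le> s" "s < t0" "s = 0 \<or> s \<le> tm E i - 2 * D" "tm E j \<le> s + 3 * D" "t0 - 2 * D \<le> s"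
      using t0 D_pos ti tj i(5) unfolding s_def by (auto simp: max_def min_def)
    let ?P = "present_set (changes (st (Suc j) p))" and ?G = "{q. present E q s \<and> active E q (t0 + D)}"
    note P = informed_present_set_upper[OF kn ch s(1,3,4)]

    \<comment> \<open>\<open>p\<close> counts itself as present, so the bound is positive, as the
      join test demands.\<close>
    have "Ent p \<in> changes (st (Suc j) p)"
      using event_in_changes[of ie "Ent p" "Suc j"] ie i by (simp add: event_def)
    moreover have "active_before E p j"
      using step_active[of j] j unfolding joined_echo_receipts_def by auto
    then have "Lv p \<notin> changes (st (Suc j) p)"
      using changes_occurred[of "Lv p" "Suc j" p] j
      unfolding active_before_def joined_echo_receipts_def by (auto simp: less_Suc_eq)
    ultimately have "?P \<noteq> {}" by (auto simp: present_set_def)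
    with P(1) have "0 < card ?P" by (simp add: card_gt_0_iff)
    then have pos: "0 < join_bound (st K p)"
      using gamma_pos unfolding bound join_threshold_def by simp

    \<comment> \<open>A node of \<open>?G\<close> is active until \<open>t0 + D\<close> and receives
      the enter message by then; its echo arrives within another \<open>D\<close>, before step
      \<open>K\<close>.\<close>
    have "?G \<subseteq> (\<lambda>j. recv_src (inp E j)) ` echo_receipts E p K"
    proof
      fix r assume r: "r \<in> ?G"
      then have ent: "entered E r s" by (simp add: present_def)
      have "r \<noteq> p" using not_present_early[OF s(2)] ent by blast
      moreover have "entered E r (tm E ie)" using entered_mono[OF ent] s(2) by (simp add: t0_def)
      ultimately obtain i j where
        "nd E j = p" "tm E j \<le> tm E ie + 2 * D"
        "inp E j = Recv r (MEcho (changes (st (Suc i) r)) (is_joined (st i r)) p)"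
        using echo_from_active[OF ie act, of r] r unfolding t0_def by blast
      moreover from this have "j \<in> echo_receipts E p K"
        using less_K unfolding echo_receipts_def t0_def by auto
      ultimately show "r \<in> (\<lambda>j. recv_src (inp E j)) ` echo_receipts E p K"
        by (intro image_eqI[of _ _ j]) auto
    qed
    then have "card ?G \<le> card (echo_receipts E p K)"
      by (rule surj_card_le[OF finite_echo_receipts])
    moreover have "join_bound (st K p) \<le> real (card ?G)"
    proof -
      have "join_bound (st K p) \<le> \<gamma> * ((1 + \<alpha>)^3 * N s)"
        using P(2) gamma_pos unfolding bound join_threshold_def by (intro mult_left_mono) auto
      also have "\<dots> \<le> ((1 - \<alpha>)^3 - \<Delta> * (1 + \<alpha>)^3) * N s"
        using mult_right_mono[OF gamma_upper', of "N s"] by (simp add: mult.assoc)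
      also have "\<dots> \<le> real (card ?G)"
        using s D_pos by (intro active_survivors) auto
      finally show ?thesis .
    qed
    ultimately have "join_bound (st K p) \<le> real (join_counter (st K p))"
      using inv nj by simp
    with pos inv nj show False by blast
  qed
  with K(2) show ?thesis by (rule is_joined_mono)
qed

section \<open>How events reach a node\<close>

lemma knows_observed_event:
  assumes e: "event E i e" and p: "entered E p (tm E i)" "active_before E p k" "tm E i + D < tm E k"
  shows "e \<in> changes (st k p)"
proof (cases "p = nd E i")
  case True
  have "i < k" using p(3) D_pos by (intro tm_less_imp_less) simp
  with True show ?thesis using event_in_changes[OF e] by simp
next
  case False
  obtain m where m: "out \<gamma> E i = [m]" "e \<in> carried m" using event_broadcast[OF e] by blast
  have "active E p t" if "tm E i \<le> t" "t \<le> tm E i + D" for t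
    using active_before_imp_active[OF p(2)] entered_mono[OF p(1)] that p(3) by auto
  then obtain j where j: "nd E j = p" "inp E j = Recv (nd E i) m" "tm E j \<le> tm E i + D"
    using delivery[OF m(1) False] by metis
  have "j < k" using j(3) p(3) by (intro tm_less_imp_less) simp
  then show ?thesis using carried_in_changes[OF j(2) m(2)] j(1) by simp
qed

text \<open>If \<open>r\<close> learns of the event before echoing \<open>p\<close>'s enter message, the echo carries it; otherwise
  \<open>p\<close> is already listening when \<open>r\<close> relays the event.\<close>

lemma knows_relayed_event:
  assumes e: "event E i e"
    and r: "r \<noteq> p" "entered E r (tm E i)" "active E r (tm E i + D)"
    and y: "nd E y = r" "tm E i < tm E y" "entered E p (tm E y)"
      "changes (st (Suc y) r) \<subseteq> changes (st k p)"
    and p: "active_before E p k" "tm E i + 2 * D < tm E k"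
  shows "e \<in> changes (st k p)"
proof (cases "r = nd E i")
  case True
  have "i < y" using y(2) by (rule tm_less_imp_less)
  with True show ?thesis using event_in_changes[OF e, of "Suc y"] y(4) by auto
next
  case False
  obtain m where m: "out \<gamma> E i = [m]" "e \<in> carried m" and
    relay: "\<And>j src. inp E j = Recv src m \<Longrightarrow> \<exists>m'. out \<gamma> E j = [m'] \<and> e \<in> carried m'"
    using event_broadcast[OF e] by blast
  have "active E r t" if "tm E i \<le> t" "t \<le> tm E i + D" for t
    using active_earlier[OF r(3)] entered_mono[OF r(2)] that by blast
  then obtain x where x: "nd E x = r" "inp E x = Recv (nd E i) m" "tm E x \<le> tm E i + D"
    using delivery[OF m(1) False] by metis
  show ?thesis
  proof (cases "x \<le> y")
    case True
    then show ?thesis using carried_in_changes[OF x(2) m(2), of "Suc y"] x(1) y(4) by auto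
  next
    case False
    obtain m' where m': "out \<gamma> E x = [m']" "e \<in> carried m'" using relay[OF x(2)] by blast
    have "tm E y \<le> tm E x" using False by (intro tm_mono) simp
    then have "active E p t" if "tm E x \<le> t" "t \<le> tm E x + D" for t
      using active_before_imp_active[OF p(1)] entered_mono[OF y(3)] that p(2) x(3) by auto
    then obtain z where z: "nd E z = p" "inp E z = Recv r m'" "tm E z \<le> tm E x + D"
      using delivery[OF m'(1), of p] r(1) x(1) by metis
    have "z < k" using z(3) x(3) p(2) by (intro tm_less_imp_less) simp
    then show ?thesis using carried_in_changes[OF z(2) m'(2)] z(1) by simp
  qed
qed

text \<open>A node of \<open>S0\<close> hears old events directly. Otherwise there are three cases:
  events more than \<open>2 * D\<close> before the sending of the echo that fixed the bound come
  with that echo, events since \<open>p\<close> entered are heard directly, and those in between are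
  relayed by an echoing node found by counting.\<close>

lemma knows_step:
  assumes IHK: "\<And>i q. i < k \<Longrightarrow> is_joined (st i q) \<Longrightarrow> active_before E q i \<Longrightarrow> knows i q"
    and IHT: "\<And>i ie. i < k \<Longrightarrow> inp E ie = SigEnter \<Longrightarrow> active E (nd E ie) (tm E ie + 2 * D) \<Longrightarrow>
        tm E ie + 2 * D < tm E i \<Longrightarrow> is_joined (st i (nd E ie))"
    and joined: "is_joined (st k p)" and act: "active_before E p k"
  shows "knows k p"
proof (cases "p \<in> S0 E")
  case True
  then have "Ent ` S0 E \<subseteq> changes (st k p)"
    using changes_mono[of 0 k p] by (auto simp: init_state_def)
  moreover have "e \<in> changes (st k p)" if "event E i e" "tm E i + 2 * D < tm E k" for i e
    using knows_observed_event[OF that(1) _ act] True that(2) D_pos by (simp add: entered_def)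
  ultimately show ?thesis unfolding knows_def by blast
next
  case False
  then obtain ie where ie: "inp E ie = SigEnter" "nd E ie = p"
    using act unfolding active_before_def entered_before_def by blast
  from join_inv_holds[OF False, of \<gamma> k] joined obtain j j' where
    j: "j < k" "j \<in> echo_receipts E p (Suc j)" "\<not> is_joined (st j p)"
    and j': "j' \<in> joined_echo_receipts E p (Suc j)"
    and thr: "join_threshold \<gamma> E p j' \<le> real (card (echo_receipts E p (Suc j)))"
    unfolding join_inv_def Let_def by blast
  have "j' \<le> j" using j' unfolding joined_echo_receipts_def by auto
  have "j' \<in> echo_receipts E p (Suc j)" using j' joined_echo_receipts_subset by blast
  from echo_receipt_origin[OF ie this] obtain i' where
    i': "ie < i'" "i' < j'" "inp E i' = Recv p (MEnter p)" "tm E j' \<le> tm E i' + D"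
      "changes (st (Suc i') (nd E i')) \<subseteq> changes (st (Suc j') p)" "is_joined (st i' (nd E i'))"
    using j' by metis
  have "active_before E (nd E i') i'" by (rule step_active) (simp_all add: i')
  then have kn: "knows i' (nd E i')" using IHK[of i'] i' \<open>j' \<le> j\<close> j(1) by simp
  have ch: "changes (st i' (nd E i')) \<subseteq> changes (st (Suc j') p)"
    using changes_mono[of i' "Suc i'"] i'(5) by force
  also have "\<dots> \<subseteq> changes (st k p)"
    using \<open>j' \<le> j\<close> j(1) by (intro changes_mono) simp
  finally have ch_k: "changes (st i' (nd E i')) \<subseteq> changes (st k p)" .

  define t0 where "t0 = tm E ie"
  define s where "s = max 0 (tm E i' - 2 * D)"
  have ti': "t0 \<le> tm E i'" using tm_mono[of ie i'] i'(1) by (simp add: t0_def)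
  \<comment> \<open>\<open>p\<close> is still unjoined before step \<open>j\<close>, which
    \<open>IHT\<close> excludes after the deadline. So all counted echoes were sent by
    \<open>t0 + 2 * D\<close>, hence by \<open>s + 4 * D\<close>.\<close>
  have tj: "tm E j \<le> t0 + 2 * D"
  proof (rule ccontr)
    assume late: "\<not> tm E j \<le> t0 + 2 * D"
    have "active_before E p j"
      using step_active[of j] j(2) unfolding echo_receipts_def by auto
    then have "active E p (t0 + 2 * D)"
      using late enter_imp_entered[OF ie(1)] ie(2) D_pos
      by (intro active_before_imp_active[of _ j]) (auto simp: t0_def)
    then show False using IHT[of j ie] j late ie unfolding t0_def by auto
  qed
  have "tm E i' \<le> tm E j" using i'(2) \<open>j' \<le> j\<close> by (intro tm_mono) simp
  then have s: "0 \<le> s" "s \<le> t0" "t0 - 2 * D \<le> s" "tm E j' \<le> s + 3 * D"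
    using tj ti' i'(4) tm_nonneg[of ie] unfolding s_def t0_def by auto

  let ?U = "(\<lambda>j. recv_src (inp E j)) ` echo_receipts E p (Suc j)"
  have "card ?U = card (echo_receipts E p (Suc j))"
    by (rule card_image[OF inj_on_echo_sender])
  have "((1 + \<alpha>)^4 - 1 + \<Delta> * (1 + \<alpha>)^3) * N s < \<gamma> * (2 - (1 + \<alpha>)^3) * N s"
    using churn_crash_below_threshold N_pos[OF s(1)] by (rule mult_strict_right_mono)
  also have "\<dots> \<le> join_threshold \<gamma> E p j'"
    unfolding join_threshold_def mult.assoc
    using informed_present_set_lower[OF kn ch s_def s(4)] gamma_pos by (intro mult_left_mono) auto
  also have "\<dots> \<le> real (card ?U)"
    using thr \<open>card ?U = _\<close> by simp
  finally have many_echoes: "((1 + \<alpha>)^4 - 1 + \<Delta> * (1 + \<alpha>)^3) * N s < real (card ?U)" .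

  have "e \<in> changes (st k p)" if e: "event E i e" "tm E i + 2 * D < tm E k" for i e
  proof -
    define \<tau> where "\<tau> = tm E i"
    consider "\<tau> + 2 * D < tm E i'" | "t0 \<le> \<tau>" | "tm E i' \<le> \<tau> + 2 * D" "\<tau> < t0" by linarith
    then show ?thesis
    proof cases
      case 1
      then show ?thesis using kn ch_k e(1) unfolding knows_def \<tau>_def by blast
    next
      case 2
      then have "entered E p (tm E i)"
        using enter_imp_entered[OF ie(1)] ie(2) unfolding \<tau>_def t0_def by blast
      then show ?thesis using knows_observed_event[OF e(1) _ act] e(2) D_pos by simp
    next
      case 3
      then have \<tau>: "s \<le> \<tau>" "\<tau> + D \<le> s + 3 * D" "0 \<le> \<tau>"
        using s tm_nonneg[of i] unfolding s_def \<tau>_def by auto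
      \<comment> \<open>The senders to discard. Any other sender is present from \<open>s\<close> on
        and active until \<open>\<tau> + D\<close>, so the broadcast of the event reaches
        it.\<close>
      let ?C = "churned s (s + 4 * D)"
        and ?K = "{q. present E q (\<tau> + D) \<and> crashed E q (\<tau> + D)}"
      have fin: "finite (?C \<union> ?K)"
        using churned_4D(1)[OF s(1)] finite_present[of "\<tau> + D"] \<tau>(3) D_pos by auto
      have "real (card (?C \<union> ?K)) \<le> real (card ?C) + real (card ?K)"
        using card_Un_le[of ?C ?K] by linarith
      also have "\<dots> \<le> ((1 + \<alpha>)^4 - 1) * N s + \<Delta> * ((1 + \<alpha>)^3 * N s)"
      proof -
        have "N (\<tau> + D) \<le> (1 + \<alpha>)^3 * N s" using \<tau> D_pos by (intro N_3D[OF s(1)]) auto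
        from mult_left_mono[OF this Delta_nonneg] show ?thesis
          using churned_4D(2)[OF s(1)] crashed_bound[of "\<tau> + D"] \<tau>(3) D_pos by linarith
      qed
      also have "\<dots> < real (card ?U)"
        using many_echoes by (simp add: algebra_simps)
      finally have "\<not> ?U \<subseteq> ?C \<union> ?K" using card_mono[OF fin, of ?U] by linarith
      then obtain j'' where j'': "j'' \<in> echo_receipts E p (Suc j)"
        and r: "recv_src (inp E j'') \<notin> ?C" "recv_src (inp E j'') \<notin> ?K" by blast
      from echo_receipt_origin[OF ie j''] obtain y where
        y: "ie < y" "y < j''" "nd E y \<noteq> p" "recv_src (inp E j'') = nd E y"
          "inp E y = Recv p (MEnter p)"
          "changes (st (Suc y) (nd E y)) \<subseteq> changes (st (Suc j'') p)" by metis
      have "j'' \<le> j" using j'' unfolding echo_receipts_def by simp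
      have ty: "t0 \<le> tm E y" "tm E y \<le> t0 + 2 * D"
        using tm_mono[of ie y] tm_mono[of y j] y(1,2) \<open>j'' \<le> j\<close> tj by (auto simp: t0_def)
      have r_act: "active_before E (nd E y) y" by (rule step_active) (simp_all add: y)
      \<comment> \<open>The sender had entered when it echoed, and an enter between \<open>s\<close>
        and that moment would be churn.\<close>
      have r_ent: "entered E (nd E y) s"
      proof -
        have "entered E (nd E y) (tm E y)"
          using r_act unfolding active_before_def
          by (intro entered_before_imp_entered[of _ y]) auto
        then show ?thesis
          using r(1) ty s(3) unfolding y(4) entered_def churned_def by (auto, smt (verit))
      qed
      have "\<not> has_left E (nd E y) s"
      proof
        assume "has_left E (nd E y) s"
        then obtain l where l: "inp E l = SigLeave (nd E y)" "tm E l \<le> s"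
          unfolding has_left_def by blast
        with r(1) have "tm E l < s" using D_pos unfolding y(4) churned_def by force
        with s(2) ty(1) have "l < y" by (intro tm_less_imp_less) simp
        with l(1) r_act show False unfolding active_before_def by blast
      qed
      with r_ent have "\<not> has_left E (nd E y) (s + 4 * D)"
        using r(1) unfolding y(4) by (intro unchurned_not_left[of _ s]) (auto simp: present_def)
      then have "present E (nd E y) (\<tau> + D)"
        using entered_mono[OF r_ent] \<tau> D_pos unfolding present_def has_left_def by fastforce
      with r(2) have "active E (nd E y) (tm E i + D)" unfolding y(4) active_def \<tau>_def by simp
      moreover have "entered E p (tm E y)"
        using enter_imp_entered[OF ie(1)] ie(2) ty(1) by (simp add: t0_def)
      moreover have "changes (st (Suc y) (nd E y)) \<subseteq> changes (st k p)"
        using y(6) changes_mono[of "Suc j''" k p] \<open>j'' \<le> j\<close> j(1) by auto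
      ultimately show ?thesis
        using knows_relayed_event[OF e(1) y(3) _ _ refl _ _ _ act e(2)]
          entered_mono[OF r_ent \<tau>(1)] 3(2) ty(1) unfolding \<tau>_def by auto
    qed
  qed
  moreover have "Ent ` S0 E \<subseteq> changes (st k p)" using kn ch_k unfolding knows_def by blast
  ultimately show ?thesis unfolding knows_def by blast
qed

text \<open>Each claim at \<open>k\<close> rests on both claims at earlier steps, hence the joint
  strong induction. The deadline is expressed through the steps that come after it.\<close>

lemma knows_and_joins_in_time:
  "(\<forall>p. is_joined (st k p) \<longrightarrow> active_before E p k \<longrightarrow> knows k p) \<and>
   (\<forall>ie. inp E ie = SigEnter \<longrightarrow> active E (nd E ie) (tm E ie + 2 * D) \<longrightarrow>
      tm E ie + 2 * D < tm E k \<longrightarrow> is_joined (st k (nd E ie)))"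
proof (induction k rule: less_induct)
  case (less k)
  have IHK: "knows i q" if "i < k" "is_joined (st i q)" "active_before E q i" for i q
    using less.IH[OF that(1)] that(2,3) by blast
  have IHT: "is_joined (st i (nd E ie))" if "i < k" "inp E ie = SigEnter"
    "active E (nd E ie) (tm E ie + 2 * D)" "tm E ie + 2 * D < tm E i" for i ie
    using less.IH[OF that(1)] that(2-) by blast
  have "knows k p" if "is_joined (st k p)" "active_before E p k" for p
    using _ _ that by (rule knows_step) (fact IHK IHT)+
  moreover have "is_joined (st k (nd E ie))" if "inp E ie = SigEnter"
    "active E (nd E ie) (tm E ie + 2 * D)" "tm E ie + 2 * D < tm E k" for ie
    using _ _ that(1) refl that(2,3) by (rule joins_in_time_step) (fact IHK IHT)+
  ultimately show ?case by blast
qed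

end

theorem theorem1:
  fixes E :: "'n execution" and \<gamma> \<alpha> \<Delta> D :: real and Nmin :: nat
    and p :: 'n and ie :: nat
  assumes "D > 0"
    and "0 \<le> \<alpha>" and "\<alpha> < 1" and "0 \<le> \<Delta>" and "\<Delta> < 1"
    and "\<alpha> \<le> 1 - 2 powr (-1/4)"
    and "1 < ((1 - \<alpha>)^3 - \<Delta> * (1 + \<alpha>)^3) * real Nmin"
    and "\<gamma> \<ge> 1 / (real Nmin * (1 - \<alpha>)^3) + (1 + \<Delta>) * ((1 + \<alpha>)^3 / (1 - \<alpha>)^3) - 1"
    and "\<gamma> \<le> (1 - \<alpha>)^3 / (1 + \<alpha>)^3 - \<Delta>"
    and "ccreg_execution \<gamma> D E"
    and "\<forall>t\<ge>0. Npres E t \<ge> Nmin"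
    and "churn_ok \<alpha> D E"
    and "failures_ok \<Delta> E"
    and "p \<notin> S0 E"
    and "nd E ie = p" and "inp E ie = SigEnter"
    and "active E p (tm E ie + 2 * D)"
  shows "joined_by \<gamma> E p (tm E ie + 2 * D)"
proof -
  interpret ccreg_bounded E \<gamma> D \<alpha> \<Delta> Nmin
    using assms by unfold_locales auto
  define K where "K = (LEAST m. tm E ie + 2 * D < tm E m)"
  have K: "tm E ie + 2 * D < tm E K"
    unfolding K_def by (rule LeastI_ex) (use times_unbounded in blast)
  then have "is_joined (st K p)"
    using knows_and_joins_in_time[of K] assms by blast
  \<comment> \<open>\<open>K\<close> has a predecessor because step \<open>ie\<close> precedes it.
    That predecessor is the last step at or before the deadline, and \<open>st K\<close> is the
    state right after it.\<close>
  moreover have "ie < K" using K assms(1) by (intro tm_less_imp_less) simp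
  then obtain j where "K = Suc j" by (cases K) auto
  moreover from this have "tm E j \<le> tm E ie + 2 * D"
    using not_less_Least[of j "\<lambda>m. tm E ie + 2 * D < tm E m"] unfolding K_def by simp
  ultimately show ?thesis unfolding joined_by_def by blast
qed

end
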